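(* Let $\mathbf{P}$ be a small additive category. The essential image of the functor $\overline{M}: \mathcal{Q}(\mathbf{P}) \rightarrow \mathrm{Mod}\text{-}\mathbf{P}$ is the smallest full and replete additive subcategory $\mathbf{F} \subseteq \mathrm{Mod}\text{-}\mathbf{P}$ with the following properties: (1) $\mathrm{fp}(\mathbf{P}^{\mathrm{op}}, \mathrm{Ab}) \subseteq \mathbf{F}$; (2) $\mathbf{F}$ is closed under taking images in $\mathrm{Mod}\text{-}\mathbf{P}$.
   Context: Composition is written diagrammatically: for $\alpha: A \to B$ and $\beta: B \to C$, the composite is $\alpha\cdot\beta: A \to C$. Functors between additive categories are additive. A cospan in $\mathbf{P}$ is a pair of morphisms $(A \xrightarrow{\gamma} B \xleftarrow{\rho} C)$ with common codomain. $\mathrm{Syz}(A \xrightarrow{\gamma} B \xleftarrow{\rho} C)$ is the full subcategory of the slice category of $\mathbf{P}$ over $A$ whose objects, called syzygies, are the morphisms $\sigma: S \to A$ for which there exists $\omega: S \to C$ (a syzygy witness) with $\sigma\cdot\gamma = \omega\cdot\rho$. The additive category $\mathrm{Aux}(\mathbf{P})$ has as objects the cospans $(A \xrightarrow{\gamma_A} \Omega_A \xleftarrow{\rho_A} R_A)$ in $\mathbf{P}$; a morphism from $(A \xrightarrow{\gamma_A} \Omega_A \xleftarrow{\rho_A} R_A)$ to $(B \xrightarrow{\gamma_B} \Omega_B \xleftarrow{\rho_B} R_B)$ is a morphism $\alpha: A \to B$ in $\mathbf{P}$ such that $\sigma \in \mathrm{Syz}(A \xrightarrow{\gamma_A} \Omega_A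 \xleftarrow{\rho_A} R_A)$ implies $\sigma\cdot\alpha \in \mathrm{Syz}(B \xrightarrow{\gamma_B} \Omega_B \xleftarrow{\rho_B} R_B)$; composition and identities are those of $\mathbf{P}$. The ideal $\mathbf{I}(\mathbf{P})$ of $\mathrm{Aux}(\mathbf{P})$ consists of the morphisms $\alpha$ (notation as before) for which there exists $\zeta: A \to R_B$ with $\alpha\cdot\gamma_B = \zeta\cdot\rho_B$. $\mathcal{Q}(\mathbf{P}) := \mathrm{Aux}(\mathbf{P})/\mathbf{I}(\mathbf{P})$ is the additive quotient category; the class of $\alpha$ is denoted $\overline{\alpha}$. $\mathrm{Mod}\text{-}\mathbf{P}$ is the category of additive functors $\mathbf{P}^{\mathrm{op}} \to \mathrm{Ab}$; write $(-,A) := \mathrm{Hom}_{\mathbf{P}}(-,A)$. The functor $\overline{M}$ sends $(A \xrightarrow{\gamma_A} \Omega_A \xleftarrow{\rho_A} R_A)$ to $\frac{\mathrm{im}(-,\gamma_A)}{\mathrm{im}(-,\rho_A)\cap \mathrm{im}(-,\gamma_A)}$ (a subquotient of $(-,\Omega_A)$). With $\epsilon_A: (-,A) \to \frac{\mathrm{im}(-,\gamma_A)}{\mathrm{im}(-,\rho_A)\cap \mathrm{im}(-,\gamma_A)}$ the natural epimorphism (coastriction of $(-,\gamma_A)$ to its image followed by projection), $\overline{M}(\overline{\alpha})$ is the unique morphism with $\epsilon_A \cdot \overline{M}(\overline{\alpha}) = (-,\alpha)\cdot \epsilon_B$. A subcategory $\mathbf{A}$ of $\mathbf{B}$ is replete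 if for any $X \in \mathbf{A}$ and any isomorphism $\iota: X \to Y$ in $\mathbf{B}$, $\iota$ belongs to $\mathbf{A}$. The essential image of $\overline{M}$ is the smallest full replete subcategory of $\mathrm{Mod}\text{-}\mathbf{P}$ containing all objects $\overline{M}(X)$, $X \in \mathcal{Q}(\mathbf{P})$. $\mathrm{fp}(\mathbf{P}^{\mathrm{op}}, \mathrm{Ab})$ is the full subcategory of $\mathrm{Mod}\text{-}\mathbf{P}$ of finitely presented functors, i.e. those $F$ admitting an exact sequence $(-,B) \xrightarrow{(-,\alpha)} (-,A) \to F \to 0$ for some morphism $\alpha: B \to A$ in $\mathbf{P}$. *)

theory Defs
  imports "HOL-Algebra.Coset"
begin

section \<open>Preadditive and additive categories\<close>

text \<open>
  Categories are given by hom-families: hom-sets of different pairs of objects need not be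
  disjoint (in \<open>Aux P\<close> below the same arrow of \<open>P\<close> is a morphism between many pairs of
  cospans), so the composition carries its three objects. It is written diagrammatically:
  \<open>cmp C A B D f g\<close> is ``first \<open>f : A \<rightarrow> B\<close>, then \<open>g : B \<rightarrow> D\<close>''.
  Abelian groups are represented by the multiplicative records of HOL-Algebra; thus
  \<open>\<otimes>\<close> and \<open>\<one>\<close> of a hom-group are the sum and the zero morphism.
  Since the objects form a set, every such category is small.
\<close>

record ('o, 'm) pcat =
  Obj :: "'o set"
  Hom :: "'o \<Rightarrow> 'o \<Rightarrow> 'm monoid"
  ident :: "'o \<Rightarrow> 'm"
  cmp :: "'o \<Rightarrow> 'o \<Rightarrow> 'o \<Rightarrow> 'm \<Rightarrow> 'm \<Rightarrow> 'm"

abbreviation arrows :: "('o, 'm) pcat \<Rightarrow> 'o \<Rightarrow> 'o \<Rightarrow> 'm set" where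
  "arrows C A B \<equiv> carrier (Hom C A B)"

locale preadditive_category =
  fixes C :: "('o, 'm) pcat"
  assumes Hom_comm_group:
      "\<lbrakk>A \<in> Obj C; B \<in> Obj C\<rbrakk> \<Longrightarrow> comm_group (Hom C A B)"
    and ident_closed: "A \<in> Obj C \<Longrightarrow> ident C A \<in> arrows C A A"
    and cmp_closed:
      "\<lbrakk>A \<in> Obj C; B \<in> Obj C; D \<in> Obj C; f \<in> arrows C A B; g \<in> arrows C B D\<rbrakk>
        \<Longrightarrow> cmp C A B D f g \<in> arrows C A D"
    and cmp_ident_left:
      "\<lbrakk>A \<in> Obj C; B \<in> Obj C; f \<in> arrows C A B\<rbrakk> \<Longrightarrow> cmp C A A B (ident C A) f = f"
    and cmp_ident_right:
      "\<lbrakk>A \<in> Obj C; B \<in> Obj C; f \<in> arrows C A B\<rbrakk> \<Longrightarrow> cmp C A B B f (ident C B) = f"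
    and cmp_assoc:
      "\<lbrakk>A \<in> Obj C; B \<in> Obj C; D \<in> Obj C; E \<in> Obj C;
        f \<in> arrows C A B; g \<in> arrows C B D; h \<in> arrows C D E\<rbrakk>
        \<Longrightarrow> cmp C A D E (cmp C A B D f g) h = cmp C A B E f (cmp C B D E g h)"
    and cmp_add_left:
      "\<lbrakk>A \<in> Obj C; B \<in> Obj C; D \<in> Obj C;
        f \<in> arrows C A B; f' \<in> arrows C A B; g \<in> arrows C B D\<rbrakk>
        \<Longrightarrow> cmp C A B D (f \<otimes>\<^bsub>Hom C A B\<^esub> f') g
            = cmp C A B D f g \<otimes>\<^bsub>Hom C A D\<^esub> cmp C A B D f' g"
    and cmp_add_right:
      "\<lbrakk>A \<in> Obj C; B \<in> Obj C; D \<in> Obj C;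
        f \<in> arrows C A B; g \<in> arrows C B D; g' \<in> arrows C B D\<rbrakk>
        \<Longrightarrow> cmp C A B D f (g \<otimes>\<^bsub>Hom C B D\<^esub> g')
            = cmp C A B D f g \<otimes>\<^bsub>Hom C A D\<^esub> cmp C A B D f g'"

definition zero_object :: "('o, 'm) pcat \<Rightarrow> 'o \<Rightarrow> bool" where
  "zero_object C Z \<longleftrightarrow> Z \<in> Obj C \<and>
    (\<forall>A\<in>Obj C. (\<exists>!f. f \<in> arrows C Z A) \<and> (\<exists>!f. f \<in> arrows C A Z))"

definition biproduct ::
  "('o, 'm) pcat \<Rightarrow> 'o \<Rightarrow> 'o \<Rightarrow> 'o \<Rightarrow> 'm \<Rightarrow> 'm \<Rightarrow> 'm \<Rightarrow> 'm \<Rightarrow> bool" where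
  "biproduct C A B S i j p q \<longleftrightarrow>
    S \<in> Obj C \<and>
    i \<in> arrows C A S \<and> j \<in> arrows C B S \<and> p \<in> arrows C S A \<and> q \<in> arrows C S B \<and>
    cmp C A S A i p = ident C A \<and> cmp C B S B j q = ident C B \<and>
    cmp C A S B i q = \<one>\<^bsub>Hom C A B\<^esub> \<and> cmp C B S A j p = \<one>\<^bsub>Hom C B A\<^esub> \<and>
    cmp C S A S p i \<otimes>\<^bsub>Hom C S S\<^esub> cmp C S B S q j = ident C S"

locale additive_category = preadditive_category +
  assumes ex_zero_object: "\<exists>Z. zero_object C Z"
    and ex_biproduct:
      "\<lbrakk>A \<in> Obj C; B \<in> Obj C\<rbrakk> \<Longrightarrow> \<exists>S i j p q. biproduct C A B S i j p q"

definition isomorphism :: "('o, 'm) pcat \<Rightarrow> 'o \<Rightarrow> 'o \<Rightarrow> 'm \<Rightarrow> bool" where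
  "isomorphism C A B f \<longleftrightarrow> f \<in> arrows C A B \<and>
    (\<exists>g\<in>arrows C B A. cmp C A B A f g = ident C A \<and> cmp C B A B g f = ident C B)"

section \<open>Full subcategories and essential images\<close>

text \<open>
  A full subcategory is given by its set of objects; inclusion of full subcategories is then
  inclusion of these sets.
\<close>

definition full_subcategory :: "('o, 'm) pcat \<Rightarrow> 'o set \<Rightarrow> ('o, 'm) pcat" where
  "full_subcategory C S = C\<lparr>Obj := S\<rparr>"

text \<open>For a full subcategory, an isomorphism belongs to it as soon as both of its ends do.\<close>

definition replete :: "('o, 'm) pcat \<Rightarrow> 'o set \<Rightarrow> bool" where
  "replete C S \<longleftrightarrow> (\<forall>X\<in>S. \<forall>Y\<in>Obj C. \<forall>f. isomorphism C X Y f \<longrightarrow> Y \<in> S)"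

definition full_replete_additive_subcategory :: "('o, 'm) pcat \<Rightarrow> 'o set \<Rightarrow> bool" where
  "full_replete_additive_subcategory C S \<longleftrightarrow>
    S \<subseteq> Obj C \<and> replete C S \<and> additive_category (full_subcategory C S)"

record ('o, 'm, 'p, 'n) pfunctor =
  on_obj :: "'o \<Rightarrow> 'p"
  on_arr :: "'o \<Rightarrow> 'o \<Rightarrow> 'm \<Rightarrow> 'n"

definition essential_image ::
  "('o, 'm) pcat \<Rightarrow> ('p, 'n) pcat \<Rightarrow> ('o, 'm, 'p, 'n) pfunctor \<Rightarrow> 'p set" where
  "essential_image C D \<Phi> =
    \<Inter>{S. S \<subseteq> Obj D \<and> replete D S \<and> on_obj \<Phi> ` Obj C \<subseteq> S}"

section \<open>Additive functors to abelian groups\<close>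

text \<open>
  A functor \<open>P\<^sup>o\<^sup>p \<rightarrow> Ab\<close> with values in abelian groups whose elements have type \<open>'v\<close>.
  For \<open>f : A \<rightarrow> B\<close>, the map \<open>res F A B f\<close> goes from \<open>val F B\<close> to \<open>val F A\<close>.
\<close>

record ('o, 'm, 'v) presheaf =
  val :: "'o \<Rightarrow> 'v monoid"
  res :: "'o \<Rightarrow> 'o \<Rightarrow> 'm \<Rightarrow> 'v \<Rightarrow> 'v"

definition additive_presheaf :: "('o, 'm) pcat \<Rightarrow> ('o, 'm, 'v) presheaf \<Rightarrow> bool" where
  "additive_presheaf P F \<longleftrightarrow>
    (\<forall>A\<in>Obj P. comm_group (val F A)) \<and>
    (\<forall>A\<in>Obj P. \<forall>B\<in>Obj P. \<forall>f\<in>arrows P A B. res F A B f \<in> hom (val F B) (val F A)) \<and>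
    (\<forall>A\<in>Obj P. \<forall>x\<in>carrier (val F A). res F A A (ident P A) x = x) \<and>
    (\<forall>A\<in>Obj P. \<forall>B\<in>Obj P. \<forall>D\<in>Obj P. \<forall>f\<in>arrows P A B. \<forall>g\<in>arrows P B D.
       \<forall>x\<in>carrier (val F D). res F A D (cmp P A B D f g) x = res F A B f (res F B D g x)) \<and>
    (\<forall>A\<in>Obj P. \<forall>B\<in>Obj P. \<forall>f\<in>arrows P A B. \<forall>g\<in>arrows P A B. \<forall>x\<in>carrier (val F B).
       res F A B (f \<otimes>\<^bsub>Hom P A B\<^esub> g) x = res F A B f x \<otimes>\<^bsub>val F A\<^esub> res F A B g x)"

text \<open>
  Natural transformations are extensional, so that equality of morphisms is equality of all
  components. Presheaves themselves are not normalised outside of their carriers: presheaves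
  which differ only there are distinct but isomorphic objects.
\<close>

definition nat_transf ::
  "('o, 'm) pcat \<Rightarrow> ('o, 'm, 'v) presheaf \<Rightarrow> ('o, 'm, 'w) presheaf \<Rightarrow> ('o \<Rightarrow> 'v \<Rightarrow> 'w) set" where
  "nat_transf P F G = {\<eta> \<in> extensional (Obj P).
    (\<forall>A\<in>Obj P. \<eta> A \<in> hom (val F A) (val G A) \<inter> extensional (carrier (val F A))) \<and>
    (\<forall>A\<in>Obj P. \<forall>B\<in>Obj P. \<forall>f\<in>arrows P A B. \<forall>x\<in>carrier (val F B).
       \<eta> A (res F A B f x) = res G A B f (\<eta> B x))}"

text \<open>\<open>ModCat P\<close> is \<open>Mod-P\<close>, for abelian groups with elements in the type \<open>'v\<close>.\<close>

definition ModCat :: "('o, 'm) pcat \<Rightarrow> (('o, 'm, 'v) presheaf, 'o \<Rightarrow> 'v \<Rightarrow> 'v) pcat" where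
  "ModCat P = \<lparr>
    Obj = {F. additive_presheaf P F},
    Hom = (\<lambda>F G. \<lparr>
      carrier = nat_transf P F G,
      monoid.mult = (\<lambda>\<eta> \<theta>. \<lambda>A\<in>Obj P. \<lambda>x\<in>carrier (val F A). \<eta> A x \<otimes>\<^bsub>val G A\<^esub> \<theta> A x),
      one = (\<lambda>A\<in>Obj P. \<lambda>x\<in>carrier (val F A). \<one>\<^bsub>val G A\<^esub>)\<rparr>),
    ident = (\<lambda>F. \<lambda>A\<in>Obj P. \<lambda>x\<in>carrier (val F A). x),
    cmp = (\<lambda>F G H \<eta> \<theta>. \<lambda>A\<in>Obj P. \<lambda>x\<in>carrier (val F A). \<theta> A (\<eta> A x))\<rparr>"

definition representable :: "('o, 'm) pcat \<Rightarrow> 'o \<Rightarrow> ('o, 'm, 'm) presheaf" where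
  "representable P A = \<lparr>val = (\<lambda>C. Hom P C A), res = (\<lambda>C D f x. cmp P C D A f x)\<rparr>"

definition representable_map ::
  "('o, 'm) pcat \<Rightarrow> 'o \<Rightarrow> 'o \<Rightarrow> 'm \<Rightarrow> 'o \<Rightarrow> 'm \<Rightarrow> 'm" where
  "representable_map P A B \<alpha> = (\<lambda>C\<in>Obj P. \<lambda>x\<in>arrows P C A. cmp P C A B x \<alpha>)"

definition image_presheaf ::
  "('o, 'm, 'v) presheaf \<Rightarrow> ('o, 'm, 'w) presheaf \<Rightarrow> ('o \<Rightarrow> 'v \<Rightarrow> 'w) \<Rightarrow> ('o, 'm, 'w) presheaf"
  where
  "image_presheaf F G \<eta> = \<lparr>
    val = (\<lambda>A. (val G A)\<lparr>carrier := \<eta> A ` carrier (val F A)\<rparr>),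
    res = res G\<rparr>"

text \<open>Intersection of two subfunctors of a common functor.\<close>

definition inter_presheaf ::
  "('o, 'm, 'v) presheaf \<Rightarrow> ('o, 'm, 'v) presheaf \<Rightarrow> ('o, 'm, 'v) presheaf" where
  "inter_presheaf F G = \<lparr>
    val = (\<lambda>A. (val F A)\<lparr>carrier := carrier (val F A) \<inter> carrier (val G A)\<rparr>),
    res = res F\<rparr>"

text \<open>
  Quotient of \<open>F\<close> by a subfunctor \<open>K\<close>. In the restriction maps, all sets in the union are the
  same coset.
\<close>

definition quotient_presheaf ::
  "('o, 'm, 'v) presheaf \<Rightarrow> ('o, 'm, 'v) presheaf \<Rightarrow> ('o, 'm, 'v set) presheaf" where
  "quotient_presheaf F K = \<lparr>
    val = (\<lambda>A. val F A Mod carrier (val K A)),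
    res = (\<lambda>A B f S. \<Union>x\<in>S. carrier (val K A) #>\<^bsub>val F A\<^esub> res F A B f x)\<rparr>"

definition quotient_map ::
  "('o, 'm) pcat \<Rightarrow> ('o, 'm, 'v) presheaf \<Rightarrow> ('o, 'm, 'v) presheaf \<Rightarrow> 'o \<Rightarrow> 'v \<Rightarrow> 'v set" where
  "quotient_map P F K =
    (\<lambda>A\<in>Obj P. \<lambda>x\<in>carrier (val F A). carrier (val K A) #>\<^bsub>val F A\<^esub> x)"

section \<open>The universe of group elements\<close>

text \<open>
  \<open>Mod-P\<close> needs one type of group elements which accommodates the values of the representable
  functors (arrows of \<open>P\<close>) and of their subquotients (cosets, i.e. sets of arrows). The third
  summand makes the universe arbitrarily large: the type \<open>'u\<close> is unconstrained.
\<close>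

datatype ('m, 'u) elem = Arrow 'm | Arrows "'m set" | Other 'u

type_synonym ('o, 'm, 'u) "module" = "('o, 'm, ('m, 'u) elem) presheaf"
type_synonym ('o, 'm, 'u) module_map = "'o \<Rightarrow> ('m, 'u) elem \<Rightarrow> ('m, 'u) elem"

text \<open>Transport of structure along an injection \<open>h\<close> of element types.\<close>

definition transport :: "('v \<Rightarrow> 'w) \<Rightarrow> ('o, 'm, 'v) presheaf \<Rightarrow> ('o, 'm, 'w) presheaf" where
  "transport h F = \<lparr>
    val = (\<lambda>A. \<lparr>carrier = h ` carrier (val F A),
      monoid.mult = (\<lambda>x y. h (the_inv h x \<otimes>\<^bsub>val F A\<^esub> the_inv h y)),
      one = h \<one>\<^bsub>val F A\<^esub>\<rparr>),
    res = (\<lambda>A B f x. h (res F A B f (the_inv h x)))\<rparr>"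

definition transport_map ::
  "('o, 'm) pcat \<Rightarrow> ('v \<Rightarrow> 'v') \<Rightarrow> ('w \<Rightarrow> 'w') \<Rightarrow> ('o, 'm, 'v) presheaf \<Rightarrow>
    ('o \<Rightarrow> 'v \<Rightarrow> 'w) \<Rightarrow> 'o \<Rightarrow> 'v' \<Rightarrow> 'w'" where
  "transport_map P h k F \<eta> =
    (\<lambda>A\<in>Obj P. \<lambda>x\<in>h ` carrier (val F A). k (\<eta> A (the_inv h x)))"

text \<open>The objects \<open>(-, A)\<close> and the morphisms \<open>(-, \<alpha>)\<close> of \<open>Mod-P\<close>.\<close>

definition yoneda :: "('o, 'm) pcat \<Rightarrow> 'o \<Rightarrow> ('o, 'm, 'u) module" where
  "yoneda P A = transport Arrow (representable P A)"

definition yoneda_map :: "('o, 'm) pcat \<Rightarrow> 'o \<Rightarrow> 'o \<Rightarrow> 'm \<Rightarrow> ('o, 'm, 'u) module_map" where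
  "yoneda_map P A B \<alpha> =
    transport_map P Arrow Arrow (representable P A) (representable_map P A B \<alpha>)"

text \<open>Exactness of \<open>F \<rightarrow> G \<rightarrow> H \<rightarrow> 0\<close> in \<open>Mod-P\<close>, which is tested at each object of \<open>P\<close>.\<close>

definition right_exact_seq ::
  "('o, 'm) pcat \<Rightarrow> ('o, 'm, 'v) presheaf \<Rightarrow> ('o, 'm, 'v) presheaf \<Rightarrow> ('o, 'm, 'v) presheaf \<Rightarrow>
    ('o \<Rightarrow> 'v \<Rightarrow> 'v) \<Rightarrow> ('o \<Rightarrow> 'v \<Rightarrow> 'v) \<Rightarrow> bool" where
  "right_exact_seq P F G H \<eta> \<theta> \<longleftrightarrow>
    \<eta> \<in> arrows (ModCat P) F G \<and> \<theta> \<in> arrows (ModCat P) G H \<and>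
    (\<forall>A\<in>Obj P. \<eta> A ` carrier (val F A) = kernel (val G A) (val H A) (\<theta> A) \<and>
       \<theta> A ` carrier (val G A) = carrier (val H A))"

definition fp :: "('o, 'm) pcat \<Rightarrow> ('o, 'm, 'u) module set" where
  "fp P = {F \<in> Obj (ModCat P). \<exists>A\<in>Obj P. \<exists>B\<in>Obj P. \<exists>\<alpha>\<in>arrows P B A. \<exists>\<pi>.
    right_exact_seq P (yoneda P B) (yoneda P A) F (yoneda_map P B A \<alpha>) \<pi>}"

definition closed_under_images :: "('o, 'm) pcat \<Rightarrow> ('o, 'm, 'v) presheaf set \<Rightarrow> bool" where
  "closed_under_images P S \<longleftrightarrow>
    (\<forall>F\<in>S. \<forall>G\<in>S. \<forall>\<eta>\<in>arrows (ModCat P) F G. image_presheaf F G \<eta> \<in> S)"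

section \<open>Cospans, syzygies and the category \<open>Q(P)\<close>\<close>

text \<open>The cospan \<open>A \<rightarrow> \<Omega> \<leftarrow> R\<close> with legs \<open>\<gamma>\<close> (from \<open>A\<close>) and \<open>\<rho>\<close> (from \<open>R\<close>).\<close>

record ('o, 'm) cospan =
  src :: 'o
  gam :: 'm
  apex :: 'o
  rho :: 'm
  rel :: 'o

definition cospans :: "('o, 'm) pcat \<Rightarrow> ('o, 'm) cospan set" where
  "cospans P = {X. src X \<in> Obj P \<and> apex X \<in> Obj P \<and> rel X \<in> Obj P \<and>
    gam X \<in> arrows P (src X) (apex X) \<and> rho X \<in> arrows P (rel X) (apex X)}"

text \<open>The syzygies of the cospan \<open>X\<close> with domain \<open>S\<close>.\<close>

definition Syz :: "('o, 'm) pcat \<Rightarrow> ('o, 'm) cospan \<Rightarrow> 'o \<Rightarrow> 'm set" where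
  "Syz P X S = {\<sigma> \<in> arrows P S (src X). \<exists>\<omega>\<in>arrows P S (rel X).
    cmp P S (src X) (apex X) \<sigma> (gam X) = cmp P S (rel X) (apex X) \<omega> (rho X)}"

definition Aux :: "('o, 'm) pcat \<Rightarrow> (('o, 'm) cospan, 'm) pcat" where
  "Aux P = \<lparr>
    Obj = cospans P,
    Hom = (\<lambda>X Y. (Hom P (src X) (src Y))\<lparr>carrier :=
      {\<alpha> \<in> arrows P (src X) (src Y).
        \<forall>S\<in>Obj P. \<forall>\<sigma>\<in>Syz P X S. cmp P S (src X) (src Y) \<sigma> \<alpha> \<in> Syz P Y S}\<rparr>),
    ident = (\<lambda>X. ident P (src X)),
    cmp = (\<lambda>X Y Z. cmp P (src X) (src Y) (src Z))\<rparr>"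

definition aux_ideal :: "('o, 'm) pcat \<Rightarrow> ('o, 'm) cospan \<Rightarrow> ('o, 'm) cospan \<Rightarrow> 'm set" where
  "aux_ideal P X Y = {\<alpha> \<in> arrows (Aux P) X Y. \<exists>\<zeta>\<in>arrows P (src X) (rel Y).
    cmp P (src X) (src Y) (apex Y) \<alpha> (gam Y) = cmp P (src X) (rel Y) (apex Y) \<zeta> (rho Y)}"

text \<open>
  Quotient of a preadditive category by a two-sided ideal \<open>I\<close>; the class of a morphism is its
  coset. All sets in the unions defining the composition are the same coset.
\<close>

definition quotient_category ::
  "('o, 'm) pcat \<Rightarrow> ('o \<Rightarrow> 'o \<Rightarrow> 'm set) \<Rightarrow> ('o, 'm set) pcat" where
  "quotient_category C I = \<lparr>
    Obj = Obj C,
    Hom = (\<lambda>X Y. Hom C X Y Mod I X Y),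
    ident = (\<lambda>X. I X X #>\<^bsub>Hom C X X\<^esub> ident C X),
    cmp = (\<lambda>X Y Z a b. \<Union>\<alpha>\<in>a. \<Union>\<beta>\<in>b. I X Z #>\<^bsub>Hom C X Z\<^esub> cmp C X Y Z \<alpha> \<beta>)\<rparr>"

definition QCat :: "('o, 'm) pcat \<Rightarrow> (('o, 'm) cospan, 'm set) pcat" where
  "QCat P = quotient_category (Aux P) (aux_ideal P)"

section \<open>The functor from \<open>Q(P)\<close> to \<open>Mod-P\<close>\<close>

definition im_gam :: "('o, 'm) pcat \<Rightarrow> ('o, 'm) cospan \<Rightarrow> ('o, 'm, 'm) presheaf" where
  "im_gam P X = image_presheaf (representable P (src X)) (representable P (apex X))
    (representable_map P (src X) (apex X) (gam X))"

definition im_rho :: "('o, 'm) pcat \<Rightarrow> ('o, 'm) cospan \<Rightarrow> ('o, 'm, 'm) presheaf" where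
  "im_rho P X = image_presheaf (representable P (rel X)) (representable P (apex X))
    (representable_map P (rel X) (apex X) (rho X))"

definition Mbar_obj :: "('o, 'm) pcat \<Rightarrow> ('o, 'm) cospan \<Rightarrow> ('o, 'm, 'u) module" where
  "Mbar_obj P X = transport Arrows
    (quotient_presheaf (im_gam P X) (inter_presheaf (im_rho P X) (im_gam P X)))"

text \<open>The natural epimorphism \<open>(-, A) \<rightarrow> Mbar X\<close>, where \<open>A = src X\<close>.\<close>

definition eps :: "('o, 'm) pcat \<Rightarrow> ('o, 'm) cospan \<Rightarrow> ('o, 'm, 'u) module_map" where
  "eps P X = transport_map P Arrow Arrows (representable P (src X))
    (\<lambda>C. quotient_map P (im_gam P X) (inter_presheaf (im_rho P X) (im_gam P X)) C
       \<circ> representable_map P (src X) (apex X) (gam X) C)"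

definition Mbar_arr ::
  "('o, 'm) pcat \<Rightarrow> ('o, 'm) cospan \<Rightarrow> ('o, 'm) cospan \<Rightarrow> 'm set \<Rightarrow> ('o, 'm, 'u) module_map" where
  "Mbar_arr P X Y a = (THE \<eta>. \<eta> \<in> arrows (ModCat P) (Mbar_obj P X) (Mbar_obj P Y) \<and>
    (\<forall>\<alpha>\<in>a. cmp (ModCat P) (yoneda P (src X)) (Mbar_obj P X) (Mbar_obj P Y) (eps P X) \<eta> =
      cmp (ModCat P) (yoneda P (src X)) (yoneda P (src Y)) (Mbar_obj P Y)
        (yoneda_map P (src X) (src Y) \<alpha>) (eps P Y)))"

definition Mbar ::
  "('o, 'm) pcat \<Rightarrow>
    (('o, 'm) cospan, 'm set, ('o, 'm, 'u) module, ('o, 'm, 'u) module_map) pfunctor" where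
  "Mbar P = \<lparr>on_obj = Mbar_obj P, on_arr = Mbar_arr P\<rparr>"

end

theory Submission
  imports Defs
begin

text \<open>
  A module is isomorphic to some \<open>Mbar X\<close> iff it has a generator \<open>x\<close> whose annihilator is the ideal
  of syzygies of \<open>X\<close>. If \<open>G\<close> is generated by \<open>y\<close> with annihilator the syzygies of
  \<open>B \<rightarrow> \<Omega> \<leftarrow> R\<close>, then the image of a morphism \<open>F \<rightarrow> G\<close> which sends a generator of \<open>F\<close> to \<open>\<beta>\<cdot>y\<close>
  is generated by \<open>\<beta>\<cdot>y\<close>, and the annihilator of \<open>\<beta>\<cdot>y\<close> consists of the syzygies of
  \<open>A \<rightarrow> B \<rightarrow> \<Omega> \<leftarrow> R\<close>. Finitely presented modules are those for which the left leg can be chosen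
  to be an identity, and every left leg arises by taking an image between two of them.
\<close>

text \<open>Images are what leads out of \<open>fp\<close>: the kernel of the epimorphism from the
  representable functor of \<open>src X\<close> onto \<open>Mbar_obj P X\<close> is the presheaf of
  syzygies, and it is finitely generated only if all syzygies of X factor through a single one,
  which \<open>P\<close> need not provide. So the relations of a module are recorded by the
  predicate \<open>f \<in> Syz P X S\<close> instead of by an arrow. Fixing a generator makes all
  arguments elementwise: a morphism out of the module is the choice of an element killed by the
  annihilator of the generator, and two morphisms agree once they agree on the generator. The
  description is thereby invariant under isomorphism and independent of how cosets are coded in
  \<open>elem\<close>. Additivity of the essential image needs a construction of its own. Direct
  sums come from cospans whose three vertices are biproducts in \<open>P\<close>: a syzygy of such a
  cospan amounts to a pair of syzygies.\<close>

section \<open>Elementary rules for presheaves and natural transformations\<close>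

lemma presheaf_comm_group: "additive_presheaf P F \<Longrightarrow> A \<in> Obj P \<Longrightarrow> comm_group (val F A)"
  by (simp add: additive_presheaf_def)

lemma presheaf_group: "additive_presheaf P F \<Longrightarrow> A \<in> Obj P \<Longrightarrow> group (val F A)"
  by (simp add: presheaf_comm_group comm_group.axioms)

lemma presheaf_monoid: "additive_presheaf P F \<Longrightarrow> A \<in> Obj P \<Longrightarrow> monoid (val F A)"
  by (simp add: presheaf_group group.is_monoid)

lemma res_hom:
  assumes "additive_presheaf P F" "A \<in> Obj P" "B \<in> Obj P" "f \<in> arrows P A B"
  shows "res F A B f \<in> hom (val F B) (val F A)"
  using assms by (simp add: additive_presheaf_def)

lemma res_closed:
  assumes "additive_presheaf P F" "A \<in> Obj P" "B \<in> Obj P" "f \<in> arrows P A B"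
    "x \<in> carrier (val F B)"
  shows "res F A B f x \<in> carrier (val F A)"
  using hom_in_carrier[OF res_hom] assms by metis

lemma res_mult:
  assumes "additive_presheaf P F" "A \<in> Obj P" "B \<in> Obj P" "f \<in> arrows P A B"
    "x \<in> carrier (val F B)" "y \<in> carrier (val F B)"
  shows "res F A B f (x \<otimes>\<^bsub>val F B\<^esub> y) = res F A B f x \<otimes>\<^bsub>val F A\<^esub> res F A B f y"
  using hom_mult[OF res_hom] assms by metis

lemma res_one:
  assumes "additive_presheaf P F" "A \<in> Obj P" "B \<in> Obj P" "f \<in> arrows P A B"
  shows "res F A B f \<one>\<^bsub>val F B\<^esub> = \<one>\<^bsub>val F A\<^esub>"
  using hom_one[OF res_hom presheaf_group presheaf_group] assms by metis

lemma res_ident: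
  "\<lbrakk>additive_presheaf P F; A \<in> Obj P; x \<in> carrier (val F A)\<rbrakk> \<Longrightarrow> res F A A (ident P A) x = x"
  by (simp add: additive_presheaf_def)

lemma res_cmp:
  assumes "additive_presheaf P F" "A \<in> Obj P" "B \<in> Obj P" "D \<in> Obj P"
    "f \<in> arrows P A B" "g \<in> arrows P B D" "x \<in> carrier (val F D)"
  shows "res F A D (cmp P A B D f g) x = res F A B f (res F B D g x)"
  using assms by (simp add: additive_presheaf_def)

lemma res_add:
  assumes "additive_presheaf P F" "A \<in> Obj P" "B \<in> Obj P"
    "f \<in> arrows P A B" "g \<in> arrows P A B" "x \<in> carrier (val F B)"
  shows "res F A B (f \<otimes>\<^bsub>Hom P A B\<^esub> g) x = res F A B f x \<otimes>\<^bsub>val F A\<^esub> res F A B g x"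
  using assms by (simp add: additive_presheaf_def)

lemma nat_transf_hom:
  "\<eta> \<in> nat_transf P F G \<Longrightarrow> A \<in> Obj P \<Longrightarrow> \<eta> A \<in> hom (val F A) (val G A)"
  by (simp add: nat_transf_def)

lemma nat_transf_closed:
  "\<eta> \<in> nat_transf P F G \<Longrightarrow> A \<in> Obj P \<Longrightarrow> x \<in> carrier (val F A) \<Longrightarrow> \<eta> A x \<in> carrier (val G A)"
  using hom_in_carrier[OF nat_transf_hom] by metis

lemma nat_transf_mult:
  assumes "\<eta> \<in> nat_transf P F G" "A \<in> Obj P" "x \<in> carrier (val F A)" "y \<in> carrier (val F A)"
  shows "\<eta> A (x \<otimes>\<^bsub>val F A\<^esub> y) = \<eta> A x \<otimes>\<^bsub>val G A\<^esub> \<eta> A y"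
  using hom_mult[OF nat_transf_hom] assms by metis

lemma nat_transf_one:
  assumes "\<eta> \<in> nat_transf P F G" "additive_presheaf P F" "additive_presheaf P G" "A \<in> Obj P"
  shows "\<eta> A \<one>\<^bsub>val F A\<^esub> = \<one>\<^bsub>val G A\<^esub>"
  using hom_one[OF nat_transf_hom presheaf_group presheaf_group] assms by metis

lemma nat_transf_res:
  assumes "\<eta> \<in> nat_transf P F G" "A \<in> Obj P" "B \<in> Obj P" "f \<in> arrows P A B"
    "x \<in> carrier (val F B)"
  shows "\<eta> A (res F A B f x) = res G A B f (\<eta> B x)"
  using assms by (simp add: nat_transf_def)

lemma nat_transfI:
  assumes "\<eta> \<in> extensional (Obj P)"
    and "\<And>A. A \<in> Obj P \<Longrightarrow> \<eta> A \<in> extensional (carrier (val F A))"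
    and "\<And>A x. A \<in> Obj P \<Longrightarrow> x \<in> carrier (val F A) \<Longrightarrow> \<eta> A x \<in> carrier (val G A)"
    and "\<And>A x y. A \<in> Obj P \<Longrightarrow> x \<in> carrier (val F A) \<Longrightarrow> y \<in> carrier (val F A) \<Longrightarrow>
      \<eta> A (x \<otimes>\<^bsub>val F A\<^esub> y) = \<eta> A x \<otimes>\<^bsub>val G A\<^esub> \<eta> A y"
    and "\<And>A B f x. A \<in> Obj P \<Longrightarrow> B \<in> Obj P \<Longrightarrow> f \<in> arrows P A B \<Longrightarrow> x \<in> carrier (val F B) \<Longrightarrow>
      \<eta> A (res F A B f x) = res G A B f (\<eta> B x)"
  shows "\<eta> \<in> nat_transf P F G"
  using assms by (auto simp: nat_transf_def hom_def)

lemma nat_transf_eqI: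
  assumes "\<eta> \<in> nat_transf P F G" "\<theta> \<in> nat_transf P F H"
    and "\<And>A x. A \<in> Obj P \<Longrightarrow> x \<in> carrier (val F A) \<Longrightarrow> \<eta> A x = \<theta> A x"
  shows "\<eta> = \<theta>"
proof
  fix A
  show "\<eta> A = \<theta> A"
  proof (cases "A \<in> Obj P")
    case True
    then have "\<eta> A \<in> extensional (carrier (val F A))" "\<theta> A \<in> extensional (carrier (val F A))"
      using assms(1,2) by (auto simp: nat_transf_def)
    then show ?thesis using assms(3) True by (blast intro: extensionalityI)
  next
    case False
    then show ?thesis using assms(1,2) by (auto simp: nat_transf_def extensional_def)
  qed
qed

section \<open>The category of modules\<close>

lemma Obj_ModCat: "Obj (ModCat P) = {F. additive_presheaf P F}"
  and arrows_ModCat: "arrows (ModCat P) F G = nat_transf P F G"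
  and one_ModCat: "\<one>\<^bsub>Hom (ModCat P) F G\<^esub> = (\<lambda>A\<in>Obj P. \<lambda>x\<in>carrier (val F A). \<one>\<^bsub>val G A\<^esub>)"
  and mult_ModCat: "\<eta> \<otimes>\<^bsub>Hom (ModCat P) F G\<^esub> \<theta> =
    (\<lambda>A\<in>Obj P. \<lambda>x\<in>carrier (val F A). \<eta> A x \<otimes>\<^bsub>val G A\<^esub> \<theta> A x)"
  and ident_ModCat: "ident (ModCat P) F = (\<lambda>A\<in>Obj P. \<lambda>x\<in>carrier (val F A). x)"
  and cmp_ModCat: "cmp (ModCat P) F G H \<eta> \<theta> =
    (\<lambda>A\<in>Obj P. \<lambda>x\<in>carrier (val F A). \<theta> A (\<eta> A x))"
  by (simp_all add: ModCat_def)

lemma zero_nat_transf: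
  assumes F: "additive_presheaf P F" and G: "additive_presheaf P G"
  shows "\<one>\<^bsub>Hom (ModCat P) F G\<^esub> \<in> nat_transf P F G"
  unfolding one_ModCat
proof (rule nat_transfI; (simp; fail)?)
  show "(\<lambda>A\<in>Obj P. \<lambda>x\<in>carrier (val F A). \<one>\<^bsub>val G A\<^esub>) A x \<in> carrier (val G A)"
    if "A \<in> Obj P" "x \<in> carrier (val F A)" for A x
    using that presheaf_monoid[OF G] by simp
  show "(\<lambda>A\<in>Obj P. \<lambda>x\<in>carrier (val F A). \<one>\<^bsub>val G A\<^esub>) A (x \<otimes>\<^bsub>val F A\<^esub> y) =
    (\<lambda>A\<in>Obj P. \<lambda>x\<in>carrier (val F A). \<one>\<^bsub>val G A\<^esub>) A x \<otimes>\<^bsub>val G A\<^esub>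
    (\<lambda>A\<in>Obj P. \<lambda>x\<in>carrier (val F A). \<one>\<^bsub>val G A\<^esub>) A y"
    if "A \<in> Obj P" "x \<in> carrier (val F A)" "y \<in> carrier (val F A)" for A x y
    using that presheaf_monoid[OF G] presheaf_monoid[OF F] by (simp add: monoid.m_closed)
qed (use res_closed[OF F] res_one[OF G] in simp)

lemma ident_nat_transf:
  assumes F: "additive_presheaf P F"
  shows "ident (ModCat P) F \<in> nat_transf P F F"
  unfolding ident_ModCat
  by (rule nat_transfI)
    (use presheaf_monoid[OF F] res_closed[OF F] in \<open>simp_all add: monoid.m_closed\<close>)

lemma cmp_nat_transf:
  assumes F: "additive_presheaf P F"
    and \<eta>: "\<eta> \<in> nat_transf P F G" and \<theta>: "\<theta> \<in> nat_transf P G H"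
  shows "cmp (ModCat P) F G H \<eta> \<theta> \<in> nat_transf P F H"
  unfolding cmp_ModCat
  by (rule nat_transfI)
    (use presheaf_monoid[OF F] res_closed[OF F] nat_transf_closed[OF \<eta>] nat_transf_closed[OF \<theta>]
      nat_transf_mult[OF \<eta>] nat_transf_mult[OF \<theta>] nat_transf_res[OF \<eta>] nat_transf_res[OF \<theta>]
      in \<open>simp_all add: monoid.m_closed\<close>)

lemma add_nat_transf:
  assumes F: "additive_presheaf P F" and G: "additive_presheaf P G"
    and \<eta>: "\<eta> \<in> nat_transf P F G" and \<theta>: "\<theta> \<in> nat_transf P F G"
  shows "\<eta> \<otimes>\<^bsub>Hom (ModCat P) F G\<^esub> \<theta> \<in> nat_transf P F G"
  unfolding mult_ModCat
proof (rule nat_transfI; (simp; fail)?)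
  note closed = nat_transf_closed[OF \<eta>] nat_transf_closed[OF \<theta>]
  let ?s = "\<lambda>A\<in>Obj P. \<lambda>x\<in>carrier (val F A). \<eta> A x \<otimes>\<^bsub>val G A\<^esub> \<theta> A x"
  show "?s A x \<in> carrier (val G A)" if "A \<in> Obj P" "x \<in> carrier (val F A)" for A x
    using that presheaf_monoid[OF G] by (simp add: closed monoid.m_closed)
  show "?s A (x \<otimes>\<^bsub>val F A\<^esub> y) = ?s A x \<otimes>\<^bsub>val G A\<^esub> ?s A y"
    if A: "A \<in> Obj P" and x: "x \<in> carrier (val F A)" and y: "y \<in> carrier (val F A)" for A x y
  proof -
    interpret GA: comm_group "val G A" by (rule presheaf_comm_group[OF G A])
    show ?thesis
      using A x y presheaf_monoid[OF F A]
      by (simp add: monoid.m_closed nat_transf_mult[OF \<eta>] nat_transf_mult[OF \<theta>] GA.m_ac closed)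
  qed
  show "?s A (res F A B f x) = res G A B f (?s B x)"
    if "A \<in> Obj P" "B \<in> Obj P" "f \<in> arrows P A B" "x \<in> carrier (val F B)" for A B f x
    using that by (simp add: res_closed[OF F] nat_transf_res[OF \<eta>] nat_transf_res[OF \<theta>]
        res_mult[OF G] closed)
qed

lemma neg_nat_transf:
  assumes F: "additive_presheaf P F" and G: "additive_presheaf P G"
    and \<eta>: "\<eta> \<in> nat_transf P F G"
  shows "(\<lambda>A\<in>Obj P. \<lambda>x\<in>carrier (val F A). inv\<^bsub>val G A\<^esub> (\<eta> A x)) \<in> nat_transf P F G" (is "?s \<in> _")
proof (rule nat_transfI; (simp; fail)?)
  note closed = nat_transf_closed[OF \<eta>]
  show "?s A x \<in> carrier (val G A)" if "A \<in> Obj P" "x \<in> carrier (val F A)" for A x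
    using that presheaf_group[OF G] by (simp add: closed group.inv_closed)
  show "?s A (x \<otimes>\<^bsub>val F A\<^esub> y) = ?s A x \<otimes>\<^bsub>val G A\<^esub> ?s A y"
    if A: "A \<in> Obj P" and x: "x \<in> carrier (val F A)" and y: "y \<in> carrier (val F A)" for A x y
  proof -
    interpret GA: comm_group "val G A" by (rule presheaf_comm_group[OF G A])
    show ?thesis
      using A x y presheaf_monoid[OF F A]
      by (simp add: monoid.m_closed nat_transf_mult[OF \<eta>] GA.inv_mult closed)
  qed
  show "?s A (res F A B f x) = res G A B f (?s B x)"
    if A: "A \<in> Obj P" and B: "B \<in> Obj P" and f: "f \<in> arrows P A B" and x: "x \<in> carrier (val F B)"
    for A B f x
  proof -
    interpret r: group_hom "val G B" "val G A" "res G A B f"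
      using presheaf_group[OF G] res_hom[OF G A B f] A B
      by (simp add: group_hom_def group_hom_axioms_def)
    show ?thesis
      using A B f x by (simp add: res_closed[OF F] nat_transf_res[OF \<eta>] closed)
  qed
qed

lemma ModCat_Hom_comm_group:
  assumes F: "additive_presheaf P F" and G: "additive_presheaf P G"
  shows "comm_group (Hom (ModCat P) F G)"
proof (rule comm_groupI, unfold arrows_ModCat)
  note add = add_nat_transf[OF F G] and G' = presheaf_comm_group[OF G]
  note eqI = nat_transf_eqI[of _ P F G _ G]
  show "\<eta> \<otimes>\<^bsub>Hom (ModCat P) F G\<^esub> \<theta> \<in> nat_transf P F G"
    if "\<eta> \<in> nat_transf P F G" "\<theta> \<in> nat_transf P F G" for \<eta> \<theta>
    using add that .
  show "\<one>\<^bsub>Hom (ModCat P) F G\<^esub> \<in> nat_transf P F G"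
    by (rule zero_nat_transf[OF F G])
  show "\<eta> \<otimes>\<^bsub>Hom (ModCat P) F G\<^esub> \<theta> \<otimes>\<^bsub>Hom (ModCat P) F G\<^esub> \<mu> =
      \<eta> \<otimes>\<^bsub>Hom (ModCat P) F G\<^esub> (\<theta> \<otimes>\<^bsub>Hom (ModCat P) F G\<^esub> \<mu>)"
    if "\<eta> \<in> nat_transf P F G" "\<theta> \<in> nat_transf P F G" "\<mu> \<in> nat_transf P F G" for \<eta> \<theta> \<mu>
  proof (rule eqI)
    show "(\<eta> \<otimes>\<^bsub>Hom (ModCat P) F G\<^esub> \<theta> \<otimes>\<^bsub>Hom (ModCat P) F G\<^esub> \<mu>) A x =
      (\<eta> \<otimes>\<^bsub>Hom (ModCat P) F G\<^esub> (\<theta> \<otimes>\<^bsub>Hom (ModCat P) F G\<^esub> \<mu>)) A x"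
      if "A \<in> Obj P" "x \<in> carrier (val F A)" for A x
      using that \<open>\<eta> \<in> _\<close> \<open>\<theta> \<in> _\<close> \<open>\<mu> \<in> _\<close>
      by (simp add: mult_ModCat nat_transf_closed monoid.m_assoc[OF presheaf_monoid[OF G]])
  qed (intro add that)+
  show "\<eta> \<otimes>\<^bsub>Hom (ModCat P) F G\<^esub> \<theta> = \<theta> \<otimes>\<^bsub>Hom (ModCat P) F G\<^esub> \<eta>"
    if "\<eta> \<in> nat_transf P F G" "\<theta> \<in> nat_transf P F G" for \<eta> \<theta>
  proof (rule eqI)
    show "(\<eta> \<otimes>\<^bsub>Hom (ModCat P) F G\<^esub> \<theta>) A x = (\<theta> \<otimes>\<^bsub>Hom (ModCat P) F G\<^esub> \<eta>) A x"
      if "A \<in> Obj P" "x \<in> carrier (val F A)" for A x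
      using that \<open>\<eta> \<in> _\<close> \<open>\<theta> \<in> _\<close>
      by (simp add: mult_ModCat nat_transf_closed
          comm_monoid.m_comm[OF comm_group.axioms(1)[OF G']])
  qed (intro add that)+
  show "\<one>\<^bsub>Hom (ModCat P) F G\<^esub> \<otimes>\<^bsub>Hom (ModCat P) F G\<^esub> \<eta> = \<eta>"
    if "\<eta> \<in> nat_transf P F G" for \<eta>
  proof (rule eqI)
    show "(\<one>\<^bsub>Hom (ModCat P) F G\<^esub> \<otimes>\<^bsub>Hom (ModCat P) F G\<^esub> \<eta>) A x = \<eta> A x"
      if "A \<in> Obj P" "x \<in> carrier (val F A)" for A x
      using that \<open>\<eta> \<in> _\<close>
      by (simp add: one_ModCat mult_ModCat nat_transf_closed monoid.l_one[OF presheaf_monoid[OF G]])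
  qed (intro add zero_nat_transf[OF F G] that)+
  show "\<exists>\<theta>\<in>nat_transf P F G. \<theta> \<otimes>\<^bsub>Hom (ModCat P) F G\<^esub> \<eta> = \<one>\<^bsub>Hom (ModCat P) F G\<^esub>"
    if "\<eta> \<in> nat_transf P F G" for \<eta>
    by (rule bexI[OF _ neg_nat_transf[OF F G that]])
      (use that in \<open>auto simp: one_ModCat mult_ModCat nat_transf_closed
         group.l_inv[OF presheaf_group[OF G]] intro!: restrict_ext\<close>)
qed

text \<open>Passing to a full subcategory changes only \<open>Obj\<close>, and each law holds
  pointwise in the value groups. Allowing any set S of modules makes the result available for the
  presented modules.\<close>

lemma preadditive_ModCat_subcategory:
  assumes "S \<subseteq> Obj (ModCat P)"
  shows "preadditive_category (full_subcategory (ModCat P) S)"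
proof -
  have S: "additive_presheaf P F" if "F \<in> S" for F
    using assms that by (auto simp: Obj_ModCat)
  let ?C = "full_subcategory (ModCat P) S"
  have C: "Obj ?C = S" "Hom ?C = Hom (ModCat P)" "cmp ?C = cmp (ModCat P)"
    "ident ?C = ident (ModCat P)"
    by (simp_all add: full_subcategory_def)
  show ?thesis
  proof (rule preadditive_category.intro, unfold C arrows_ModCat)
    fix F G assume "F \<in> S" "G \<in> S"
    then show "comm_group (Hom (ModCat P) F G)" by (intro ModCat_Hom_comm_group S)
  next
    fix F assume "F \<in> S"
    then show "ident (ModCat P) F \<in> nat_transf P F F" by (intro ident_nat_transf S)
  next
    fix F G H \<eta> \<theta>
    assume "F \<in> S" "G \<in> S" "H \<in> S" "\<eta> \<in> nat_transf P F G" "\<theta> \<in> nat_transf P G H"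
    then show "cmp (ModCat P) F G H \<eta> \<theta> \<in> nat_transf P F H"
      by (intro cmp_nat_transf S)
  next
    fix F G \<eta> assume *: "F \<in> S" "G \<in> S" "\<eta> \<in> nat_transf P F G"
    show "cmp (ModCat P) F F G (ident (ModCat P) F) \<eta> = \<eta>"
      by (rule nat_transf_eqI[OF cmp_nat_transf[OF S ident_nat_transf[OF S]]])
        (use * in \<open>auto simp: cmp_ModCat ident_ModCat\<close>)
    show "cmp (ModCat P) F G G \<eta> (ident (ModCat P) G) = \<eta>"
      by (rule nat_transf_eqI[OF cmp_nat_transf[OF S _ ident_nat_transf[OF S]]])
        (use * in \<open>auto simp: cmp_ModCat ident_ModCat nat_transf_closed\<close>)
  next
    fix F G H K \<eta> \<theta> \<mu>
    assume "F \<in> S" "G \<in> S" "H \<in> S" "K \<in> S" and *: "\<eta> \<in> nat_transf P F G"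
    show "cmp (ModCat P) F H K (cmp (ModCat P) F G H \<eta> \<theta>) \<mu> =
      cmp (ModCat P) F G K \<eta> (cmp (ModCat P) G H K \<theta> \<mu>)"
      by (auto simp: cmp_ModCat nat_transf_closed[OF *] intro!: restrict_ext)
  next
    fix F G H \<eta> \<eta>' \<theta>
    assume "F \<in> S" "G \<in> S" "H \<in> S"
      and *: "\<eta> \<in> nat_transf P F G" "\<eta>' \<in> nat_transf P F G" "\<theta> \<in> nat_transf P G H"
    show "cmp (ModCat P) F G H (\<eta> \<otimes>\<^bsub>Hom (ModCat P) F G\<^esub> \<eta>') \<theta> =
      cmp (ModCat P) F G H \<eta> \<theta> \<otimes>\<^bsub>Hom (ModCat P) F H\<^esub> cmp (ModCat P) F G H \<eta>' \<theta>"
      using * by (auto simp: cmp_ModCat mult_ModCat nat_transf_closed nat_transf_mult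
          intro!: restrict_ext)
  next
    fix F G H \<eta> \<theta> \<theta>'
    assume "F \<in> S" "G \<in> S" "H \<in> S" and *: "\<eta> \<in> nat_transf P F G"
    show "cmp (ModCat P) F G H \<eta> (\<theta> \<otimes>\<^bsub>Hom (ModCat P) G H\<^esub> \<theta>') =
      cmp (ModCat P) F G H \<eta> \<theta> \<otimes>\<^bsub>Hom (ModCat P) F H\<^esub> cmp (ModCat P) F G H \<eta> \<theta>'"
      by (auto simp: cmp_ModCat mult_ModCat nat_transf_closed[OF *] intro!: restrict_ext)
  qed
qed

section \<open>Subfunctors, quotients and transport\<close>

text \<open>All laws are equations between elements of G, hence pass to any family of subgroups that
  is stable under restriction. Images of morphisms are such families.\<close>

lemma restrict_additive_presheaf:
  assumes G: "additive_presheaf P G"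
    and sub: "\<And>A. A \<in> Obj P \<Longrightarrow> subgroup (H A) (val G A)"
    and stable: "\<And>A B f x. \<lbrakk>A \<in> Obj P; B \<in> Obj P; f \<in> arrows P A B; x \<in> H B\<rbrakk>
      \<Longrightarrow> res G A B f x \<in> H A"
  shows "additive_presheaf P \<lparr>val = \<lambda>A. (val G A)\<lparr>carrier := H A\<rparr>, res = res G\<rparr>"
proof -
  have H: "x \<in> carrier (val G A)" if "x \<in> H A" "A \<in> Obj P" for x A
    using subgroup.mem_carrier[OF sub] that by blast
  have cg: "comm_group ((val G A)\<lparr>carrier := H A\<rparr>)" if "A \<in> Obj P" for A
    using H that group.subgroup_imp_group[OF presheaf_group[OF G that] sub[OF that]]
    by (auto intro!: group.group_comm_groupI
        simp: comm_monoid.m_comm[OF comm_group.axioms(1)[OF presheaf_comm_group[OF G]]])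
  show ?thesis
    by (auto simp: additive_presheaf_def cg hom_def stable H
        res_ident[OF G] res_mult[OF G] res_cmp[OF G] res_add[OF G])
qed

lemma image_subgroup:
  assumes "additive_presheaf P F" "additive_presheaf P G" "\<eta> \<in> nat_transf P F G" "A \<in> Obj P"
  shows "subgroup (\<eta> A ` carrier (val F A)) (val G A)"
proof -
  interpret group_hom "val F A" "val G A" "\<eta> A"
    using assms by (simp add: group_hom_def group_hom_axioms_def presheaf_group nat_transf_hom)
  show ?thesis by (rule img_is_subgroup)
qed

lemma image_stable:
  assumes F: "additive_presheaf P F" and \<eta>: "\<eta> \<in> nat_transf P F G"
    and ABf: "A \<in> Obj P" "B \<in> Obj P" "f \<in> arrows P A B" and y: "y \<in> \<eta> B ` carrier (val F B)"
  shows "res G A B f y \<in> \<eta> A ` carrier (val F A)"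
proof -
  obtain x where x: "x \<in> carrier (val F B)" "y = \<eta> B x" using y by blast
  then have "res G A B f y = \<eta> A (res F A B f x)"
    using nat_transf_res[OF \<eta> ABf] by simp
  then show ?thesis using res_closed[OF F ABf x(1)] by simp
qed

lemma image_additive_presheaf:
  assumes "additive_presheaf P F" "additive_presheaf P G" "\<eta> \<in> nat_transf P F G"
  shows "additive_presheaf P (image_presheaf F G \<eta>)"
  unfolding image_presheaf_def
  by (rule restrict_additive_presheaf)
    (use assms in \<open>auto intro: image_subgroup image_stable simp del: image_iff\<close>)

text \<open>The union in \<open>quotient_presheaf\<close> runs over all representatives of a coset.
  Since restriction maps K into K, changing the representative does not change the resulting coset,
  and the union collapses to it.\<close>

lemma quotient_res:
  assumes F: "additive_presheaf P F"
    and sub: "\<And>A. A \<in> Obj P \<Longrightarrow> subgroup (carrier (val K A)) (val F A)"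
    and stable: "\<And>A B f x. \<lbrakk>A \<in> Obj P; B \<in> Obj P; f \<in> arrows P A B; x \<in> carrier (val K B)\<rbrakk>
      \<Longrightarrow> res F A B f x \<in> carrier (val K A)"
    and A: "A \<in> Obj P" and B: "B \<in> Obj P" and f: "f \<in> arrows P A B" and x: "x \<in> carrier (val F B)"
  shows "res (quotient_presheaf F K) A B f (carrier (val K B) #>\<^bsub>val F B\<^esub> x) =
    carrier (val K A) #>\<^bsub>val F A\<^esub> res F A B f x"
proof -
  interpret FA: comm_group "val F A" by (rule presheaf_comm_group[OF F A])
  interpret FB: comm_group "val F B" by (rule presheaf_comm_group[OF F B])
  note KA = sub[OF A] and KB = sub[OF B]
  have "carrier (val K A) #>\<^bsub>val F A\<^esub> res F A B f y = carrier (val K A) #>\<^bsub>val F A\<^esub> res F A B f x"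
    if y: "y \<in> carrier (val K B) #>\<^bsub>val F B\<^esub> x" for y
  proof -
    obtain k where k: "k \<in> carrier (val K B)" "y = k \<otimes>\<^bsub>val F B\<^esub> x"
      using y by (auto simp: r_coset_def)
    have "res F A B f y = res F A B f k \<otimes>\<^bsub>val F A\<^esub> res F A B f x"
      using k x subgroup.mem_carrier[OF KB] by (simp add: res_mult[OF F A B f])
    then have "res F A B f y \<in> carrier (val K A) #>\<^bsub>val F A\<^esub> res F A B f x"
      using stable[OF A B f k(1)] by (auto simp: r_coset_def)
    then show ?thesis
      using FA.repr_independence[OF _ res_closed[OF F A B f x] KA] by simp
  qed
  moreover have "x \<in> carrier (val K B) #>\<^bsub>val F B\<^esub> x"
    by (rule FB.rcos_self[OF x KB])
  ultimately have "(\<Union>y\<in>carrier (val K B) #>\<^bsub>val F B\<^esub> x. carrier (val K A) #>\<^bsub>val F A\<^esub> res F A B f y) =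
    carrier (val K A) #>\<^bsub>val F A\<^esub> res F A B f x"
    by blast
  then show ?thesis by (simp add: quotient_presheaf_def)
qed

lemma (in preadditive_category) arrows_add_closed:
  assumes "A \<in> Obj C" "B \<in> Obj C" "f \<in> arrows C A B" "g \<in> arrows C A B"
  shows "f \<otimes>\<^bsub>Hom C A B\<^esub> g \<in> arrows C A B"
  using comm_group.axioms(2)[OF Hom_comm_group] assms by (simp add: group.is_monoid monoid.m_closed)

lemma (in preadditive_category) quotient_additive_presheaf:
  assumes F: "additive_presheaf C F"
    and sub: "\<And>A. A \<in> Obj C \<Longrightarrow> subgroup (carrier (val K A)) (val F A)"
    and stable: "\<And>A B f x. \<lbrakk>A \<in> Obj C; B \<in> Obj C; f \<in> arrows C A B; x \<in> carrier (val K B)\<rbrakk>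
      \<Longrightarrow> res F A B f x \<in> carrier (val K A)"
  shows "additive_presheaf C (quotient_presheaf F K)"
proof -
  let ?Q = "quotient_presheaf F K"
  let ?c = "\<lambda>A x. carrier (val K A) #>\<^bsub>val F A\<^esub> x"
  have Q: "val ?Q A = val F A Mod carrier (val K A)" for A
    by (simp add: quotient_presheaf_def)
  \<comment> \<open>With every element written as a coset of some x, the laws of the quotient reduce
    through \<open>r\<close> and \<open>cmult\<close> to those of F on representatives.\<close>
  have car: "carrier (val ?Q A) = ?c A ` carrier (val F A)" for A
    by (auto simp: Q FactGroup_def RCOSETS_def)
  have cmult: "?c A x \<otimes>\<^bsub>val ?Q A\<^esub> ?c A y = ?c A (x \<otimes>\<^bsub>val F A\<^esub> y)"
    if "A \<in> Obj C" "x \<in> carrier (val F A)" "y \<in> carrier (val F A)" for A x y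
    using normal.rcos_sum[OF comm_group.subgroup_imp_normal[OF presheaf_comm_group[OF F] sub]] that
    by (simp add: Q FactGroup_def)
  note r = quotient_res[OF F sub stable]
  have m: "x \<otimes>\<^bsub>val F A\<^esub> y \<in> carrier (val F A)"
    if "A \<in> Obj C" "x \<in> carrier (val F A)" "y \<in> carrier (val F A)" for A x y
    using monoid.m_closed[OF presheaf_monoid[OF F]] that .
  have cg: "comm_group (val ?Q A)" if "A \<in> Obj C" for A
    unfolding Q by (rule comm_group.abelian_FactGroup[OF presheaf_comm_group[OF F] sub]) fact+
  show ?thesis
    unfolding additive_presheaf_def hom_def car
    by (auto simp: cg r cmult m res_closed[OF F] res_ident[OF F] res_cmp[OF F] res_add[OF F]
        res_mult[OF F] ident_closed cmp_closed arrows_add_closed)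
qed

lemma transport_additive_presheaf:
  assumes F: "additive_presheaf P F" and h: "inj h"
  shows "additive_presheaf P (transport h F)"
proof -
  have [simp]: "the_inv h (h x) = x" for x using the_inv_f_f[OF h] .
  have "comm_group (val (transport h F) A)" if A: "A \<in> Obj P" for A
  proof -
    interpret comm_group "val F A" by (rule presheaf_comm_group[OF F A])
    show ?thesis
    proof (rule comm_groupI)
      fix x assume "x \<in> carrier (val (transport h F) A)"
      then obtain a where "a \<in> carrier (val F A)" "x = h a" by (auto simp: transport_def)
      then show "\<exists>y\<in>carrier (val (transport h F) A).
        y \<otimes>\<^bsub>val (transport h F) A\<^esub> x = \<one>\<^bsub>val (transport h F) A\<^esub>"
        by (intro bexI[of _ "h (inv\<^bsub>val F A\<^esub> a)"]) (auto simp: transport_def)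
    qed (auto simp: transport_def m_ac)
  qed
  then show ?thesis
    by (auto simp: additive_presheaf_def hom_def transport_def
        res_closed[OF F] res_ident[OF F] res_cmp[OF F] res_add[OF F] res_mult[OF F])
qed

section \<open>Modules with one generator\<close>

text \<open>Over an additive category these are the finitely generated functors with a chosen
  generator: generators over A and B combine to a single one over a biproduct of A and B.\<close>

definition generated_by :: "('o, 'm) pcat \<Rightarrow> ('o, 'm, 'v) presheaf \<Rightarrow> 'o \<Rightarrow> 'v \<Rightarrow> bool" where
  "generated_by P F A x \<longleftrightarrow> additive_presheaf P F \<and> A \<in> Obj P \<and> x \<in> carrier (val F A) \<and>
    (\<forall>S\<in>Obj P. \<forall>y\<in>carrier (val F S). \<exists>f\<in>arrows P S A. y = res F S A f x)"

text \<open>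
  By the Yoneda lemma, such an \<open>x\<close> is an epimorphism from \<open>(-, src X)\<close> to \<open>F\<close> whose kernel
  consists of the syzygies of \<open>X\<close>.
\<close>

definition presented_by ::
  "('o, 'm) pcat \<Rightarrow> ('o, 'm, 'v) presheaf \<Rightarrow> ('o, 'm) cospan \<Rightarrow> 'v \<Rightarrow> bool" where
  "presented_by P F X x \<longleftrightarrow> X \<in> cospans P \<and> generated_by P F (src X) x \<and>
    (\<forall>S\<in>Obj P. \<forall>f\<in>arrows P S (src X). res F S (src X) f x = \<one>\<^bsub>val F S\<^esub> \<longleftrightarrow> f \<in> Syz P X S)"

definition presented :: "('o, 'm) pcat \<Rightarrow> ('o, 'm, 'v) presheaf set" where
  "presented P = {F. \<exists>X x. presented_by P F X x}"

lemma generated_byD: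
  assumes "generated_by P F A x"
  shows "additive_presheaf P F" "A \<in> Obj P" "x \<in> carrier (val F A)"
  using assms by (simp_all add: generated_by_def)

lemma generated_byE:
  assumes "generated_by P F A x" "S \<in> Obj P" "y \<in> carrier (val F S)"
  obtains f where "f \<in> arrows P S A" "y = res F S A f x"
  using assms by (auto simp: generated_by_def)

lemma presented_byD:
  assumes "presented_by P F X x"
  shows "X \<in> cospans P" "generated_by P F (src X) x" "additive_presheaf P F"
    "src X \<in> Obj P" "x \<in> carrier (val F (src X))"
  using assms by (simp_all add: presented_by_def generated_by_def)

lemma presented_by_Syz:
  assumes "presented_by P F X x" "S \<in> Obj P" "f \<in> arrows P S (src X)"
  shows "res F S (src X) f x = \<one>\<^bsub>val F S\<^esub> \<longleftrightarrow> f \<in> Syz P X S"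
  using assms by (simp add: presented_by_def)

lemma presented_additive_presheaf: "F \<in> presented P \<Longrightarrow> additive_presheaf P F"
  by (auto simp: presented_def dest: presented_byD(3))

text \<open>Naturality carries agreement at x to all restrictions of x, and these exhaust F.
  Isomorphism and biproduct identities are thereby checked on one element each.\<close>

lemma generator_eqI:
  assumes gen: "generated_by P F A x"
    and \<eta>: "\<eta> \<in> nat_transf P F G" and \<theta>: "\<theta> \<in> nat_transf P F G" and eq: "\<eta> A x = \<theta> A x"
  shows "\<eta> = \<theta>"
proof (rule nat_transf_eqI[OF \<eta> \<theta>])
  fix S y assume S: "S \<in> Obj P" and y: "y \<in> carrier (val F S)"
  obtain f where f: "f \<in> arrows P S A" "y = res F S A f x" by (rule generated_byE[OF gen S y])
  show "\<eta> S y = \<theta> S y"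
    using nat_transf_res[OF \<eta> S _ f(1)] nat_transf_res[OF \<theta> S _ f(1)] generated_byD[OF gen] eq f(2)
    by simp
qed

section \<open>Morphisms out of a module with one generator\<close>

context preadditive_category
begin

lemma Hom_group: "A \<in> Obj C \<Longrightarrow> B \<in> Obj C \<Longrightarrow> group (Hom C A B)"
  by (rule comm_group.axioms(2)[OF Hom_comm_group])

text \<open>Additivity of F in the arrow, for a fixed element. It makes the annihilator of x a
  subgroup, so that equality of two restrictions of x can be tested on the difference of the
  arrows.\<close>

lemma res_arrow_group_hom:
  assumes "additive_presheaf C F" "S \<in> Obj C" "A \<in> Obj C" "x \<in> carrier (val F A)"
  shows "group_hom (Hom C S A) (val F S) (\<lambda>f. res F S A f x)"
  using assms
  by (simp add: group_hom_def group_hom_axioms_def hom_def Hom_group presheaf_group res_closed res_add)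

lemma res_zero_arrow:
  assumes "additive_presheaf C F" "S \<in> Obj C" "A \<in> Obj C" "x \<in> carrier (val F A)"
  shows "res F S A \<one>\<^bsub>Hom C S A\<^esub> x = \<one>\<^bsub>val F S\<^esub>"
  using group_hom.hom_one[OF res_arrow_group_hom[OF assms]] .

lemma zero_closed: "A \<in> Obj C \<Longrightarrow> B \<in> Obj C \<Longrightarrow> \<one>\<^bsub>Hom C A B\<^esub> \<in> arrows C A B"
  by (simp add: Hom_group group.is_monoid)

text \<open>F is the quotient of the functor represented by A by the annihilator of x. Hence sending
  each restriction of x to the restriction of y along the same arrow is well defined as soon as
  whatever kills x kills y.\<close>

lemma generator_map:
  assumes F: "generated_by C F A x" and G: "additive_presheaf C G" and y: "y \<in> carrier (val G A)"
    and ann: "\<And>S f. S \<in> Obj C \<Longrightarrow> f \<in> arrows C S A \<Longrightarrow> res F S A f x = \<one>\<^bsub>val F S\<^esub> \<Longrightarrow>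
      res G S A f y = \<one>\<^bsub>val G S\<^esub>"
  obtains \<eta> where "\<eta> \<in> nat_transf C F G" "\<eta> A x = y"
proof -
  note F' = generated_byD(1)[OF F] and A = generated_byD(2)[OF F] and x = generated_byD(3)[OF F]
  have wd: "res G S A f y = res G S A g y"
    if S: "S \<in> Obj C" and f: "f \<in> arrows C S A" and g: "g \<in> arrows C S A"
      and eq: "res F S A f x = res F S A g x" for S f g
  proof -
    interpret hF: group_hom "Hom C S A" "val F S" "\<lambda>f. res F S A f x"
      by (rule res_arrow_group_hom[OF F' S A x])
    interpret hG: group_hom "Hom C S A" "val G S" "\<lambda>f. res G S A f y"
      by (rule res_arrow_group_hom[OF G S A y])
    \<comment> \<open>The difference of f and g kills x, hence kills y by
      \<open>ann\<close>.\<close>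
    have "res F S A (f \<otimes>\<^bsub>Hom C S A\<^esub> inv\<^bsub>Hom C S A\<^esub> g) x = \<one>\<^bsub>val F S\<^esub>"
      using f g hF.hom_closed[OF g] by (simp add: eq)
    then have "res G S A (f \<otimes>\<^bsub>Hom C S A\<^esub> inv\<^bsub>Hom C S A\<^esub> g) y = \<one>\<^bsub>val G S\<^esub>"
      using ann[OF S] f g by simp
    then have "res G S A f y \<otimes>\<^bsub>val G S\<^esub> inv\<^bsub>val G S\<^esub> (res G S A g y) = \<one>\<^bsub>val G S\<^esub>"
      using f g by simp
    then show ?thesis
      using f g hG.H.inv_equality[of "res G S A f y" "inv\<^bsub>val G S\<^esub> (res G S A g y)"]
      by (simp add: hG.hom_closed)
  qed
  \<comment> \<open>Any arrow that expresses z through x may be chosen: by \<open>wd\<close> the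
    value does not depend on it, and the laws can be checked on arrows that suit them.\<close>
  define \<eta> where "\<eta> = (\<lambda>S\<in>Obj C. \<lambda>z\<in>carrier (val F S).
    res G S A (SOME f. f \<in> arrows C S A \<and> z = res F S A f x) y)"
  have \<eta>: "\<eta> S (res F S A f x) = res G S A f y" if S: "S \<in> Obj C" and f: "f \<in> arrows C S A" for S f
  proof -
    let ?g = "SOME g. g \<in> arrows C S A \<and> res F S A f x = res F S A g x"
    have "?g \<in> arrows C S A \<and> res F S A f x = res F S A ?g x"
      by (rule someI[of _ f]) (simp add: f)
    then show ?thesis
      using wd[OF S _ f, of ?g] S res_closed[OF F' S A f x] by (simp add: \<eta>_def)
  qed
  have "\<eta> \<in> nat_transf C F G"
  proof (rule nat_transfI)
    show "\<eta> \<in> extensional (Obj C)" by (simp add: \<eta>_def)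
    show "\<eta> S \<in> extensional (carrier (val F S))" if "S \<in> Obj C" for S
      using that by (simp add: \<eta>_def)
  next
    fix S z assume S: "S \<in> Obj C" and z: "z \<in> carrier (val F S)"
    obtain f where f: "f \<in> arrows C S A" "z = res F S A f x" by (rule generated_byE[OF F S z])
    then show "\<eta> S z \<in> carrier (val G S)"
      using \<eta>[OF S f(1)] res_closed[OF G S A f(1) y] by simp
  next
    fix S z w assume S: "S \<in> Obj C" and z: "z \<in> carrier (val F S)" and w: "w \<in> carrier (val F S)"
    obtain f where f: "f \<in> arrows C S A" "z = res F S A f x" by (rule generated_byE[OF F S z])
    obtain g where g: "g \<in> arrows C S A" "w = res F S A g x" by (rule generated_byE[OF F S w])
    show "\<eta> S (z \<otimes>\<^bsub>val F S\<^esub> w) = \<eta> S z \<otimes>\<^bsub>val G S\<^esub> \<eta> S w"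
      using \<eta>[OF S f(1)] \<eta>[OF S g(1)] \<eta>[OF S arrows_add_closed[OF S A f(1) g(1)]]
        res_add[OF F' S A f(1) g(1) x] res_add[OF G S A f(1) g(1) y] f(2) g(2) by simp
  next
    fix S T f z
    assume S: "S \<in> Obj C" and T: "T \<in> Obj C" and f: "f \<in> arrows C S T" and z: "z \<in> carrier (val F T)"
    obtain g where g: "g \<in> arrows C T A" "z = res F T A g x" by (rule generated_byE[OF F T z])
    show "\<eta> S (res F S T f z) = res G S T f (\<eta> T z)"
      using \<eta>[OF T g(1)] \<eta>[OF S cmp_closed[OF S T A f g(1)]]
        res_cmp[OF F' S T A f g(1) x] res_cmp[OF G S T A f g(1) y] g(2) by simp
  qed
  moreover have "\<eta> A x = y"
    using \<eta>[OF A ident_closed[OF A]] res_ident[OF F' A x] res_ident[OF G A y] by simp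
  ultimately show thesis by (rule that)
qed

text \<open>Both generators have the annihilator \<open>Syz C X\<close>, so each can be sent to the
  other. The two composites fix the generators and are therefore identities. Thus the cospan
  determines the module up to isomorphism.\<close>

lemma presented_by_iso:
  assumes F: "presented_by C F X x" and G: "presented_by C G X y"
  shows "\<exists>\<eta>. isomorphism (ModCat C) F G \<eta>"
proof -
  note F' = presented_byD[OF F] and G' = presented_byD[OF G]
  obtain \<eta> where \<eta>: "\<eta> \<in> nat_transf C F G" "\<eta> (src X) x = y"
    by (rule generator_map[OF F'(2) G'(3,5)])
      (simp_all add: presented_by_Syz[OF F] presented_by_Syz[OF G])
  obtain \<theta> where \<theta>: "\<theta> \<in> nat_transf C G F" "\<theta> (src X) y = x"
    by (rule generator_map[OF G'(2) F'(3,5)])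
      (simp_all add: presented_by_Syz[OF F] presented_by_Syz[OF G])
  have "cmp (ModCat C) F G F \<eta> \<theta> = ident (ModCat C) F"
    by (rule generator_eqI[OF F'(2) cmp_nat_transf[OF F'(3) \<eta>(1) \<theta>(1)] ident_nat_transf[OF F'(3)]])
      (simp add: cmp_ModCat ident_ModCat F' \<eta> \<theta>)
  moreover have "cmp (ModCat C) G F G \<theta> \<eta> = ident (ModCat C) G"
    by (rule generator_eqI[OF G'(2) cmp_nat_transf[OF G'(3) \<theta>(1) \<eta>(1)] ident_nat_transf[OF G'(3)]])
      (simp add: cmp_ModCat ident_ModCat G' \<eta> \<theta>)
  ultimately show ?thesis
    using \<eta>(1) \<theta>(1) by (auto simp: isomorphism_def arrows_ModCat)
qed

end

section \<open>Closure of the presented modules under isomorphisms and images\<close>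

text \<open>An isomorphism commutes with restriction and is bijective on each value group, so it
  carries a generator to a generator with the same annihilator. The cospan stays the same.\<close>

lemma isomorphism_presented_by:
  assumes F: "presented_by P F X x" and G: "additive_presheaf P G"
    and iso: "isomorphism (ModCat P) F G \<eta>"
  shows "presented_by P G X (\<eta> (src X) x)"
proof -
  note F' = presented_byD[OF F]
  obtain \<theta> where \<eta>: "\<eta> \<in> nat_transf P F G" and \<theta>: "\<theta> \<in> nat_transf P G F"
    and eq: "cmp (ModCat P) F G F \<eta> \<theta> = ident (ModCat P) F"
      "cmp (ModCat P) G F G \<theta> \<eta> = ident (ModCat P) G"
    using iso by (auto simp: isomorphism_def arrows_ModCat)
  have \<theta>\<eta>: "\<theta> S (\<eta> S a) = a" if "S \<in> Obj P" "a \<in> carrier (val F S)" for S a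
    using fun_cong[OF fun_cong[OF eq(1)], of S a] that by (simp add: cmp_ModCat ident_ModCat)
  have \<eta>\<theta>: "\<eta> S (\<theta> S a) = a" if "S \<in> Obj P" "a \<in> carrier (val G S)" for S a
    using fun_cong[OF fun_cong[OF eq(2)], of S a] that by (simp add: cmp_ModCat ident_ModCat)
  have r: "res G S (src X) f (\<eta> (src X) x) = \<eta> S (res F S (src X) f x)"
    if "S \<in> Obj P" "f \<in> arrows P S (src X)" for S f
    using nat_transf_res[OF \<eta> that(1) F'(4) that(2) F'(5)] by simp
  have "\<exists>f\<in>arrows P S (src X). y = res G S (src X) f (\<eta> (src X) x)"
    if S: "S \<in> Obj P" and y: "y \<in> carrier (val G S)" for S y
  proof -
    obtain f where f: "f \<in> arrows P S (src X)" "\<theta> S y = res F S (src X) f x"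
      by (rule generated_byE[OF F'(2) S nat_transf_closed[OF \<theta> S y]])
    then show ?thesis using r[OF S f(1)] \<eta>\<theta>[OF S y] by metis
  qed
  moreover have "\<eta> S (res F S (src X) f x) = \<one>\<^bsub>val G S\<^esub> \<longleftrightarrow> f \<in> Syz P X S"
    if S: "S \<in> Obj P" and f: "f \<in> arrows P S (src X)" for S f
    using \<theta>\<eta>[OF S res_closed[OF F'(3) S F'(4) f F'(5)]] presented_by_Syz[OF F S f]
      nat_transf_one[OF \<theta> G F'(3) S] nat_transf_one[OF \<eta> F'(3) G S] by metis
  ultimately show ?thesis
    using nat_transf_closed[OF \<eta> F'(4,5)] F'(1,4) G
    by (simp add: presented_by_def generated_by_def r)
qed

lemma presented_replete: "replete (ModCat P) (presented P)"
  by (auto simp: replete_def Obj_ModCat presented_def dest: isomorphism_presented_by)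

text \<open>
  The image of a morphism into a module presented by \<open>Y\<close> only requires a change of the left leg
  of \<open>Y\<close>.
\<close>

lemma (in preadditive_category) image_presented_by:
  assumes F: "generated_by C F A x" and G: "presented_by C G Y y"
    and \<eta>: "\<eta> \<in> nat_transf C F G" and \<beta>: "\<beta> \<in> arrows C A (src Y)"
    and eq: "\<eta> A x = res G A (src Y) \<beta> y"
  shows "presented_by C (image_presheaf F G \<eta>)
    \<lparr>src = A, gam = cmp C A (src Y) (apex Y) \<beta> (gam Y), apex = apex Y, rho = rho Y, rel = rel Y\<rparr>
    (\<eta> A x)" (is "presented_by C ?I ?X _")
proof -
  note F' = generated_byD[OF F] and G' = presented_byD[OF G]
  have Y: "apex Y \<in> Obj C" "rel Y \<in> Obj C" "gam Y \<in> arrows C (src Y) (apex Y)"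
    "rho Y \<in> arrows C (rel Y) (apex Y)"
    using G'(1) by (auto simp: cospans_def)
  have I: "val ?I S = (val G S)\<lparr>carrier := \<eta> S ` carrier (val F S)\<rparr>" "res ?I = res G" for S
    by (simp_all add: image_presheaf_def)
  have "\<exists>f\<in>arrows C S A. z = res G S A f (\<eta> A x)"
    if S: "S \<in> Obj C" and z: "z \<in> \<eta> S ` carrier (val F S)" for S z
  proof -
    obtain w where w: "w \<in> carrier (val F S)" "z = \<eta> S w" using z by blast
    obtain f where f: "f \<in> arrows C S A" "w = res F S A f x" by (rule generated_byE[OF F S w(1)])
    then show ?thesis using nat_transf_res[OF \<eta> S F'(2) f(1) F'(3)] w(2) by auto
  qed
  moreover have "res G S A f (\<eta> A x) = \<one>\<^bsub>val G S\<^esub> \<longleftrightarrow> f \<in> Syz C ?X S"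
    if S: "S \<in> Obj C" and f: "f \<in> arrows C S A" for S f
  proof -
    have "res G S A f (\<eta> A x) = res G S (src Y) (cmp C S A (src Y) f \<beta>) y"
      using res_cmp[OF G'(3) S F'(2) G'(4) f \<beta> G'(5)] eq by simp
    \<comment> \<open>By associativity, \<open>f\<cdot>\<beta>\<close> is a syzygy of Y exactly when
      f is one of \<open>?X\<close>. The witnesses are the same because the right leg is
      kept.\<close>
    then show ?thesis
      using presented_by_Syz[OF G S cmp_closed[OF S F'(2) G'(4) f \<beta>]] f
        cmp_closed[OF S F'(2) G'(4) f \<beta>] cmp_assoc[OF S F'(2) G'(4) Y(1) f \<beta> Y(3)]
      by (simp add: Syz_def)
  qed
  moreover have "?X \<in> cospans C"
    using F'(2) Y cmp_closed[OF F'(2) G'(4) Y(1) \<beta> Y(3)] by (simp add: cospans_def)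
  ultimately show ?thesis
    using F' image_additive_presheaf[OF F'(1) G'(3) \<eta>]
    by (simp add: presented_by_def generated_by_def I)
qed

lemma (in preadditive_category) presented_closed_under_images:
  "closed_under_images C (presented C)"
proof -
  have "image_presheaf F G \<eta> \<in> presented C"
    if F: "presented_by C F X x" and G: "presented_by C G Y y" and \<eta>: "\<eta> \<in> nat_transf C F G"
    for F G :: "('o, 'm, 'v) presheaf" and X Y x y \<eta>
  proof -
    note F' = presented_byD[OF F] and G' = presented_byD[OF G]
    obtain \<beta> where "\<beta> \<in> arrows C (src X) (src Y)" "\<eta> (src X) x = res G (src X) (src Y) \<beta> y"
      by (rule generated_byE[OF G'(2) F'(4) nat_transf_closed[OF \<eta> F'(4,5)]])
    then show ?thesis
      using image_presented_by[OF F'(2) G \<eta>] by (auto simp: presented_def)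
  qed
  then show ?thesis by (auto simp: closed_under_images_def arrows_ModCat presented_def[of C])
qed

section \<open>Biproducts\<close>

context preadditive_category
begin

lemma cmp_zero_left:
  assumes "A \<in> Obj C" "B \<in> Obj C" "D \<in> Obj C" "g \<in> arrows C B D"
  shows "cmp C A B D \<one>\<^bsub>Hom C A B\<^esub> g = \<one>\<^bsub>Hom C A D\<^esub>"
proof -
  interpret group_hom "Hom C A B" "Hom C A D" "\<lambda>f. cmp C A B D f g"
    using assms
    by (simp add: group_hom_def group_hom_axioms_def hom_def Hom_group cmp_closed cmp_add_left)
  show ?thesis by (rule hom_one)
qed

lemma cmp_zero_right:
  assumes "A \<in> Obj C" "B \<in> Obj C" "D \<in> Obj C" "f \<in> arrows C A B"
  shows "cmp C A B D f \<one>\<^bsub>Hom C B D\<^esub> = \<one>\<^bsub>Hom C A D\<^esub>"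
proof -
  interpret group_hom "Hom C B D" "Hom C A D" "\<lambda>g. cmp C A B D f g"
    using assms
    by (simp add: group_hom_def group_hom_axioms_def hom_def Hom_group cmp_closed cmp_add_right)
  show ?thesis by (rule hom_one)
qed

lemma biproductD:
  assumes "biproduct C A B S i j p q"
  shows "S \<in> Obj C" "i \<in> arrows C A S" "j \<in> arrows C B S" "p \<in> arrows C S A" "q \<in> arrows C S B"
    "cmp C A S A i p = ident C A" "cmp C B S B j q = ident C B"
    "cmp C A S B i q = \<one>\<^bsub>Hom C A B\<^esub>" "cmp C B S A j p = \<one>\<^bsub>Hom C B A\<^esub>"
    "cmp C S A S p i \<otimes>\<^bsub>Hom C S S\<^esub> cmp C S B S q j = ident C S"
  using assms by (simp_all add: biproduct_def)

text \<open>Existence half of the product property, from the equations alone: h is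
  \<open>f\<cdot>i + g\<cdot>j\<close>, and the mixed terms vanish because \<open>i\<cdot>q\<close>
  and \<open>j\<cdot>p\<close> are zero.\<close>

lemma biproduct_pair:
  assumes bp: "biproduct C A B S i j p q" and T: "T \<in> Obj C" and A: "A \<in> Obj C" and B: "B \<in> Obj C"
    and f: "f \<in> arrows C T A" and g: "g \<in> arrows C T B"
  obtains h where "h \<in> arrows C T S" "cmp C T S A h p = f" "cmp C T S B h q = g"
proof -
  note D = biproductD[OF bp]
  let ?f = "cmp C T A S f i" and ?g = "cmp C T B S g j"
  have fg: "?f \<in> arrows C T S" "?g \<in> arrows C T S"
    using T A B f g D by (auto intro: cmp_closed)
  interpret TA: group "Hom C T A" by (rule Hom_group[OF T A])
  interpret TB: group "Hom C T B" by (rule Hom_group[OF T B])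
  have "cmp C T S A (?f \<otimes>\<^bsub>Hom C T S\<^esub> ?g) p = f"
    using T A B f g D fg by (simp add: cmp_add_left cmp_assoc cmp_ident_right cmp_zero_right)
  moreover have "cmp C T S B (?f \<otimes>\<^bsub>Hom C T S\<^esub> ?g) q = g"
    using T A B f g D fg by (simp add: cmp_add_left cmp_assoc cmp_ident_right cmp_zero_right)
  ultimately show thesis using that arrows_add_closed[OF T D(1) fg] by blast
qed

text \<open>Uniqueness half: composing h with \<open>p\<cdot>i + q\<cdot>j\<close>, which is the
  identity, recovers h from its two components.\<close>

lemma biproduct_ext:
  assumes bp: "biproduct C A B S i j p q" and T: "T \<in> Obj C" and A: "A \<in> Obj C" and B: "B \<in> Obj C"
    and f: "f \<in> arrows C T S" and g: "g \<in> arrows C T S"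
    and p: "cmp C T S A f p = cmp C T S A g p" and q: "cmp C T S B f q = cmp C T S B g q"
  shows "f = g"
proof -
  note D = biproductD[OF bp]
  have "h = cmp C T A S (cmp C T S A h p) i \<otimes>\<^bsub>Hom C T S\<^esub> cmp C T B S (cmp C T S B h q) j"
    if h: "h \<in> arrows C T S" for h
  proof -
    have "h = cmp C T S S h (cmp C S A S p i \<otimes>\<^bsub>Hom C S S\<^esub> cmp C S B S q j)"
      using cmp_ident_right[OF T D(1) h] D(10) by simp
    also have "\<dots> = cmp C T S S h (cmp C S A S p i) \<otimes>\<^bsub>Hom C T S\<^esub> cmp C T S S h (cmp C S B S q j)"
      using D A B T h by (intro cmp_add_right cmp_closed)
    finally show ?thesis
      using cmp_assoc[OF T D(1) A D(1) h D(4,2)] cmp_assoc[OF T D(1) B D(1) h D(5,3)] by simp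
  qed
  from this[OF f] this[OF g] p q show ?thesis by simp
qed

end

text \<open>Each vertex of Z is a biproduct of the corresponding vertices of X and Y, and its legs
  act componentwise; syzygies and their witnesses then split into components. Stating the outcome
  through membership in \<open>Syz\<close> hides the apex and the relation object of Z from later
  arguments.\<close>

lemma (in additive_category) direct_sum_cospan:
  assumes X: "X \<in> cospans C" and Y: "Y \<in> cospans C"
  obtains Z i j p q where "Z \<in> cospans C" "biproduct C (src X) (src Y) (src Z) i j p q"
    "\<And>S f. S \<in> Obj C \<Longrightarrow> f \<in> arrows C S (src Z) \<Longrightarrow> f \<in> Syz C Z S \<longleftrightarrow>
      cmp C S (src Z) (src X) f p \<in> Syz C X S \<and> cmp C S (src Z) (src Y) f q \<in> Syz C Y S"
proof -
  have X': "src X \<in> Obj C" "apex X \<in> Obj C" "rel X \<in> Obj C"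
      "gam X \<in> arrows C (src X) (apex X)" "rho X \<in> arrows C (rel X) (apex X)"
    and Y': "src Y \<in> Obj C" "apex Y \<in> Obj C" "rel Y \<in> Obj C"
      "gam Y \<in> arrows C (src Y) (apex Y)" "rho Y \<in> arrows C (rel Y) (apex Y)"
    using X Y by (auto simp: cospans_def)
  obtain A i j p q where A: "biproduct C (src X) (src Y) A i j p q"
    using ex_biproduct[OF X'(1) Y'(1)] by blast
  obtain W iW jW pW qW where W: "biproduct C (apex X) (apex Y) W iW jW pW qW"
    using ex_biproduct[OF X'(2) Y'(2)] by blast
  obtain R iR jR pR qR where R: "biproduct C (rel X) (rel Y) R iR jR pR qR"
    using ex_biproduct[OF X'(3) Y'(3)] by blast
  note A' = biproductD[OF A] and W' = biproductD[OF W] and R' = biproductD[OF R]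
  obtain \<gamma> where \<gamma>: "\<gamma> \<in> arrows C A W"
    "cmp C A W (apex X) \<gamma> pW = cmp C A (src X) (apex X) p (gam X)"
    "cmp C A W (apex Y) \<gamma> qW = cmp C A (src Y) (apex Y) q (gam Y)"
    by (rule biproduct_pair[OF W A'(1) X'(2) Y'(2) cmp_closed[OF A'(1) X'(1,2) A'(4) X'(4)]
          cmp_closed[OF A'(1) Y'(1,2) A'(5) Y'(4)]])
  obtain \<rho> where \<rho>: "\<rho> \<in> arrows C R W"
    "cmp C R W (apex X) \<rho> pW = cmp C R (rel X) (apex X) pR (rho X)"
    "cmp C R W (apex Y) \<rho> qW = cmp C R (rel Y) (apex Y) qR (rho Y)"
    by (rule biproduct_pair[OF W R'(1) X'(2) Y'(2) cmp_closed[OF R'(1) X'(3,2) R'(4) X'(5)]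
          cmp_closed[OF R'(1) Y'(3,2) R'(5) Y'(5)]])
  let ?Z = "\<lparr>src = A, gam = \<gamma>, apex = W, rho = \<rho>, rel = R\<rparr>"
  show thesis
  proof (rule that[of ?Z])
    show "?Z \<in> cospans C" using A' W' R' \<gamma>(1) \<rho>(1) by (simp add: cospans_def)
    show "biproduct C (src X) (src Y) (src ?Z) i j p q" using A by simp
    fix S f assume S: "S \<in> Obj C" and "f \<in> arrows C S (src ?Z)"
    then have f: "f \<in> arrows C S A" by simp
    have fp: "cmp C S A (src X) f p \<in> arrows C S (src X)"
      and fq: "cmp C S A (src Y) f q \<in> arrows C S (src Y)"
      using S f A' X' Y' by (auto intro: cmp_closed)
    have f\<gamma>p: "cmp C S W (apex X) (cmp C S A W f \<gamma>) pW =
        cmp C S (src X) (apex X) (cmp C S A (src X) f p) (gam X)"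
      using cmp_assoc[OF S A'(1) W'(1) X'(2) f \<gamma>(1) W'(4)]
        cmp_assoc[OF S A'(1) X'(1,2) f A'(4) X'(4)] \<gamma>(2) by simp
    have f\<gamma>q: "cmp C S W (apex Y) (cmp C S A W f \<gamma>) qW =
        cmp C S (src Y) (apex Y) (cmp C S A (src Y) f q) (gam Y)"
      using cmp_assoc[OF S A'(1) W'(1) Y'(2) f \<gamma>(1) W'(5)]
        cmp_assoc[OF S A'(1) Y'(1,2) f A'(5) Y'(4)] \<gamma>(3) by simp
    have \<omega>\<rho>p: "cmp C S W (apex X) (cmp C S R W \<omega> \<rho>) pW =
        cmp C S (rel X) (apex X) (cmp C S R (rel X) \<omega> pR) (rho X)"
      if "\<omega> \<in> arrows C S R" for \<omega>
      using cmp_assoc[OF S R'(1) W'(1) X'(2) that \<rho>(1) W'(4)]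
        cmp_assoc[OF S R'(1) X'(3,2) that R'(4) X'(5)] \<rho>(2) by simp
    have \<omega>\<rho>q: "cmp C S W (apex Y) (cmp C S R W \<omega> \<rho>) qW =
        cmp C S (rel Y) (apex Y) (cmp C S R (rel Y) \<omega> qR) (rho Y)"
      if "\<omega> \<in> arrows C S R" for \<omega>
      using cmp_assoc[OF S R'(1) W'(1) Y'(2) that \<rho>(1) W'(5)]
        cmp_assoc[OF S R'(1) Y'(3,2) that R'(5) Y'(5)] \<rho>(3) by simp
    have "f \<in> Syz C ?Z S \<longleftrightarrow>
      cmp C S A (src X) f p \<in> Syz C X S \<and> cmp C S A (src Y) f q \<in> Syz C Y S"
    proof
      assume "f \<in> Syz C ?Z S"
      then obtain \<omega> where \<omega>: "\<omega> \<in> arrows C S R" "cmp C S A W f \<gamma> = cmp C S R W \<omega> \<rho>"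
        by (auto simp: Syz_def)
      have "cmp C S R (rel X) \<omega> pR \<in> arrows C S (rel X)"
        "cmp C S R (rel Y) \<omega> qR \<in> arrows C S (rel Y)"
        using S \<omega>(1) R' X' Y' by (auto intro: cmp_closed)
      then show "cmp C S A (src X) f p \<in> Syz C X S \<and> cmp C S A (src Y) f q \<in> Syz C Y S"
        using f\<gamma>p f\<gamma>q \<omega>\<rho>p[OF \<omega>(1)] \<omega>\<rho>q[OF \<omega>(1)] \<omega>(2) fp fq
        unfolding Syz_def mem_Collect_eq by metis
    next
      assume "cmp C S A (src X) f p \<in> Syz C X S \<and> cmp C S A (src Y) f q \<in> Syz C Y S"
      then obtain \<omega>X \<omega>Y where \<omega>X: "\<omega>X \<in> arrows C S (rel X)"
          "cmp C S (src X) (apex X) (cmp C S A (src X) f p) (gam X) =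
            cmp C S (rel X) (apex X) \<omega>X (rho X)"
        and \<omega>Y: "\<omega>Y \<in> arrows C S (rel Y)"
          "cmp C S (src Y) (apex Y) (cmp C S A (src Y) f q) (gam Y) =
            cmp C S (rel Y) (apex Y) \<omega>Y (rho Y)"
        by (auto simp: Syz_def)
      obtain \<omega> where \<omega>: "\<omega> \<in> arrows C S R" "cmp C S R (rel X) \<omega> pR = \<omega>X"
        "cmp C S R (rel Y) \<omega> qR = \<omega>Y"
        by (rule biproduct_pair[OF R S X'(3) Y'(3) \<omega>X(1) \<omega>Y(1)])
      \<comment> \<open>Arrows into W are compared after both projections, where the equation
        becomes that of \<open>\<omega>X\<close> and that of \<open>\<omega>Y\<close>.\<close>
      have "cmp C S A W f \<gamma> = cmp C S R W \<omega> \<rho>"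
        by (rule biproduct_ext[OF W S X'(2) Y'(2) cmp_closed[OF S A'(1) W'(1) f \<gamma>(1)]
              cmp_closed[OF S R'(1) W'(1) \<omega>(1) \<rho>(1)]])
          (simp_all add: f\<gamma>p f\<gamma>q \<omega>\<rho>p[OF \<omega>(1)] \<omega>\<rho>q[OF \<omega>(1)] \<omega>X(2) \<omega>Y(2) \<omega>(2,3))
      then show "f \<in> Syz C ?Z S" using f \<omega>(1) by (auto simp: Syz_def)
    qed
    then show "f \<in> Syz C ?Z S \<longleftrightarrow>
      cmp C S (src ?Z) (src X) f p \<in> Syz C X S \<and> cmp C S (src ?Z) (src Y) f q \<in> Syz C Y S"
      by simp
  qed
qed

lemma (in preadditive_category) zero_in_Syz:
  assumes "X \<in> cospans C" "S \<in> Obj C"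
  shows "\<one>\<^bsub>Hom C S (src X)\<^esub> \<in> Syz C X S"
  using assms
  by (auto simp: Syz_def cospans_def zero_closed cmp_zero_left intro!: bexI[OF _ zero_closed])

text \<open>The structure maps are prescribed on generators: the projections \<pi> and \<kappa> send
  z to the restrictions of x along p and of y along q, the injections \<iota> and \<mu> send x and y
  to the restrictions of z along i and j. The hypothesis on \<open>Syz C Z\<close> makes them well
  defined, and each biproduct equation, evaluated at a generator, is the corresponding equation in
  \<open>C\<close>.\<close>

lemma (in preadditive_category) biproduct_presented_by:
  assumes F: "presented_by C F X x" and G: "presented_by C G Y y" and H: "presented_by C H Z z"
    and bp: "biproduct C (src X) (src Y) (src Z) i j p q"
    and Z: "\<And>S f. S \<in> Obj C \<Longrightarrow> f \<in> arrows C S (src Z) \<Longrightarrow> f \<in> Syz C Z S \<longleftrightarrow>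
      cmp C S (src Z) (src X) f p \<in> Syz C X S \<and> cmp C S (src Z) (src Y) f q \<in> Syz C Y S"
  shows "\<exists>i j p q. biproduct (ModCat C) F G H i j p q"
proof -
  note F' = presented_byD[OF F] and G' = presented_byD[OF G] and H' = presented_byD[OF H]
    and D = biproductD[OF bp]
  note fX = res_cmp[OF F'(3)] and gY = res_cmp[OF G'(3)] and hZ = res_cmp[OF H'(3)]
  obtain \<pi> where \<pi>: "\<pi> \<in> nat_transf C H F" "\<pi> (src Z) z = res F (src Z) (src X) p x"
  proof (rule generator_map[OF H'(2) F'(3) res_closed[OF F'(3) D(1) F'(4) D(4) F'(5)]])
    fix S f assume S: "S \<in> Obj C" and f: "f \<in> arrows C S (src Z)"
      and "res H S (src Z) f z = \<one>\<^bsub>val H S\<^esub>"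
    then have "cmp C S (src Z) (src X) f p \<in> Syz C X S"
      using presented_by_Syz[OF H S f] Z[OF S f] by simp
    then show "res F S (src Z) f (res F (src Z) (src X) p x) = \<one>\<^bsub>val F S\<^esub>"
      using presented_by_Syz[OF F S cmp_closed[OF S D(1) F'(4) f D(4)]]
        fX[OF S D(1) F'(4) f D(4) F'(5)] by simp
  qed
  obtain \<kappa> where \<kappa>: "\<kappa> \<in> nat_transf C H G" "\<kappa> (src Z) z = res G (src Z) (src Y) q y"
  proof (rule generator_map[OF H'(2) G'(3) res_closed[OF G'(3) D(1) G'(4) D(5) G'(5)]])
    fix S f assume S: "S \<in> Obj C" and f: "f \<in> arrows C S (src Z)"
      and "res H S (src Z) f z = \<one>\<^bsub>val H S\<^esub>"
    then have "cmp C S (src Z) (src Y) f q \<in> Syz C Y S"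
      using presented_by_Syz[OF H S f] Z[OF S f] by simp
    then show "res G S (src Z) f (res G (src Z) (src Y) q y) = \<one>\<^bsub>val G S\<^esub>"
      using presented_by_Syz[OF G S cmp_closed[OF S D(1) G'(4) f D(5)]]
        gY[OF S D(1) G'(4) f D(5) G'(5)] by simp
  qed
  obtain \<iota> where \<iota>: "\<iota> \<in> nat_transf C F H" "\<iota> (src X) x = res H (src X) (src Z) i z"
  proof (rule generator_map[OF F'(2) H'(3) res_closed[OF H'(3) F'(4) D(1) D(2) H'(5)]])
    fix S f assume S: "S \<in> Obj C" and f: "f \<in> arrows C S (src X)"
      and "res F S (src X) f x = \<one>\<^bsub>val F S\<^esub>"
    then have "f \<in> Syz C X S" using presented_by_Syz[OF F S f] by simp
    \<comment> \<open>The components of \<open>f\<cdot>i\<close> are f itself, a syzygy of X, and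
      zero, which is a syzygy of every cospan.\<close>
    then have "cmp C S (src X) (src Z) f i \<in> Syz C Z S"
      using S f F'(4) G'(1,4) D
      by (simp add: Z cmp_closed cmp_assoc cmp_ident_right cmp_zero_right zero_in_Syz)
    then show "res H S (src X) f (res H (src X) (src Z) i z) = \<one>\<^bsub>val H S\<^esub>"
      using presented_by_Syz[OF H S cmp_closed[OF S F'(4) D(1) f D(2)]]
        hZ[OF S F'(4) D(1) f D(2) H'(5)] by simp
  qed
  obtain \<mu> where \<mu>: "\<mu> \<in> nat_transf C G H" "\<mu> (src Y) y = res H (src Y) (src Z) j z"
  proof (rule generator_map[OF G'(2) H'(3) res_closed[OF H'(3) G'(4) D(1) D(3) H'(5)]])
    fix S f assume S: "S \<in> Obj C" and f: "f \<in> arrows C S (src Y)"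
      and "res G S (src Y) f y = \<one>\<^bsub>val G S\<^esub>"
    then have "f \<in> Syz C Y S" using presented_by_Syz[OF G S f] by simp
    then have "cmp C S (src Y) (src Z) f j \<in> Syz C Z S"
      using S f F'(1,4) G'(4) D
      by (simp add: Z cmp_closed cmp_assoc cmp_ident_right cmp_zero_right zero_in_Syz)
    then show "res H S (src Y) f (res H (src Y) (src Z) j z) = \<one>\<^bsub>val H S\<^esub>"
      using presented_by_Syz[OF H S cmp_closed[OF S G'(4) D(1) f D(3)]]
        hZ[OF S G'(4) D(1) f D(3) H'(5)] by simp
  qed
  have "cmp (ModCat C) F H F \<iota> \<pi> = ident (ModCat C) F"
    by (rule generator_eqI[OF F'(2) cmp_nat_transf[OF F'(3) \<iota>(1) \<pi>(1)] ident_nat_transf[OF F'(3)]])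
      (use nat_transf_res[OF \<pi>(1) F'(4) D(1,2) H'(5)] fX[OF F'(4) D(1) F'(4) D(2,4) F'(5)] D(6)
        in \<open>simp add: cmp_ModCat ident_ModCat F' \<iota>(2) \<pi>(2) res_ident\<close>)
  moreover have "cmp (ModCat C) G H G \<mu> \<kappa> = ident (ModCat C) G"
    by (rule generator_eqI[OF G'(2) cmp_nat_transf[OF G'(3) \<mu>(1) \<kappa>(1)] ident_nat_transf[OF G'(3)]])
      (use nat_transf_res[OF \<kappa>(1) G'(4) D(1,3) H'(5)] gY[OF G'(4) D(1) G'(4) D(3,5) G'(5)] D(7)
        in \<open>simp add: cmp_ModCat ident_ModCat G' \<mu>(2) \<kappa>(2) res_ident\<close>)
  moreover have "cmp (ModCat C) F H G \<iota> \<kappa> = \<one>\<^bsub>Hom (ModCat C) F G\<^esub>"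
    by (rule generator_eqI[OF F'(2) cmp_nat_transf[OF F'(3) \<iota>(1) \<kappa>(1)]
          zero_nat_transf[OF F'(3) G'(3)]])
      (use nat_transf_res[OF \<kappa>(1) F'(4) D(1,2) H'(5)] gY[OF F'(4) D(1) G'(4) D(2,5) G'(5)] D(8)
        in \<open>simp add: cmp_ModCat one_ModCat F' G' \<iota>(2) \<kappa>(2) res_zero_arrow\<close>)
  moreover have "cmp (ModCat C) G H F \<mu> \<pi> = \<one>\<^bsub>Hom (ModCat C) G F\<^esub>"
    by (rule generator_eqI[OF G'(2) cmp_nat_transf[OF G'(3) \<mu>(1) \<pi>(1)]
          zero_nat_transf[OF G'(3) F'(3)]])
      (use nat_transf_res[OF \<pi>(1) G'(4) D(1,3) H'(5)] fX[OF G'(4) D(1) F'(4) D(3,4) F'(5)] D(9)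
        in \<open>simp add: cmp_ModCat one_ModCat F' G' \<mu>(2) \<pi>(2) res_zero_arrow\<close>)
  moreover have "cmp (ModCat C) H F H \<pi> \<iota> \<otimes>\<^bsub>Hom (ModCat C) H H\<^esub> cmp (ModCat C) H G H \<kappa> \<mu> =
      ident (ModCat C) H"
  proof (rule generator_eqI[OF H'(2) add_nat_transf[OF H'(3) H'(3)] ident_nat_transf[OF H'(3)]])
    show "cmp (ModCat C) H F H \<pi> \<iota> \<in> nat_transf C H H"
      by (rule cmp_nat_transf[OF H'(3) \<pi>(1) \<iota>(1)])
    show "cmp (ModCat C) H G H \<kappa> \<mu> \<in> nat_transf C H H"
      by (rule cmp_nat_transf[OF H'(3) \<kappa>(1) \<mu>(1)])
    \<comment> \<open>Evaluated at z, the sum of the two composites is restriction along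
      \<open>p\<cdot>i + q\<cdot>j\<close>, which is the identity of \<open>src Z\<close>.\<close>
    have "\<iota> (src Z) (\<pi> (src Z) z) \<otimes>\<^bsub>val H (src Z)\<^esub> \<mu> (src Z) (\<kappa> (src Z) z) =
      res H (src Z) (src Z) (cmp C (src Z) (src X) (src Z) p i) z \<otimes>\<^bsub>val H (src Z)\<^esub>
      res H (src Z) (src Z) (cmp C (src Z) (src Y) (src Z) q j) z"
      using nat_transf_res[OF \<iota>(1) D(1) F'(4) D(4) F'(5)] nat_transf_res[OF \<mu>(1) D(1) G'(4) D(5) G'(5)]
        hZ[OF D(1) F'(4) D(1) D(4,2) H'(5)] hZ[OF D(1) G'(4) D(1) D(5,3) H'(5)]
      by (simp add: \<pi>(2) \<kappa>(2) \<iota>(2) \<mu>(2))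
    also have "\<dots> = z"
      using res_add[OF H'(3) D(1) D(1) cmp_closed[OF D(1) F'(4) D(1,4,2)]
          cmp_closed[OF D(1) G'(4) D(1,5,3)] H'(5)] D(10) res_ident[OF H'(3) D(1) H'(5)] by simp
    finally show "(cmp (ModCat C) H F H \<pi> \<iota> \<otimes>\<^bsub>Hom (ModCat C) H H\<^esub> cmp (ModCat C) H G H \<kappa> \<mu>) (src Z) z =
      ident (ModCat C) H (src Z) z"
      by (simp add: mult_ModCat cmp_ModCat ident_ModCat H')
  qed
  ultimately show ?thesis
    using \<iota>(1) \<mu>(1) \<pi>(1) \<kappa>(1) H'(3)
    unfolding biproduct_def arrows_ModCat Obj_ModCat by blast
qed

section \<open>The modules in the image of the functor\<close>

lemma inj_Arrow: "inj Arrow" and inj_Arrows: "inj Arrows"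
  by (simp_all add: inj_def)

lemma the_inv_Arrow [simp]: "the_inv Arrow (Arrow f) = f"
  and the_inv_Arrows [simp]: "the_inv Arrows (Arrows A) = A"
  by (simp_all add: the_inv_f_f inj_Arrow inj_Arrows)

context preadditive_category
begin

lemma representable_additive_presheaf:
  "A \<in> Obj C \<Longrightarrow> additive_presheaf C (representable C A)"
  by (auto simp: additive_presheaf_def representable_def Hom_comm_group hom_def cmp_closed
      cmp_add_left cmp_add_right cmp_ident_left cmp_assoc)

lemma representable_map_nat_transf:
  assumes "A \<in> Obj C" "B \<in> Obj C" "\<alpha> \<in> arrows C A B"
  shows "representable_map C A B \<alpha> \<in> nat_transf C (representable C A) (representable C B)"
  using assms
  by (intro nat_transfI)
    (simp_all add: representable_def representable_map_def cmp_closed arrows_add_closed cmp_add_left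
      cmp_assoc)

text \<open>The generator is the class of \<open>gam X\<close>, that is, of the identity of
  \<open>src X\<close> composed with \<open>gam X\<close>. Its restriction along f is the class of
  \<open>f\<cdot>gam X\<close>, which is zero exactly when f has a syzygy witness.\<close>

lemma Mbar_presented_by:
  assumes X: "X \<in> cospans C"
  defines "K \<equiv> inter_presheaf (im_rho C X) (im_gam C X)"
  shows "presented_by C (Mbar_obj C X :: ('o, 'm, 'u) module) X
    (Arrows (carrier (val K (src X)) #>\<^bsub>val (im_gam C X) (src X)\<^esub> gam X))"
proof -
  let ?G = "im_gam C X" and ?R = "im_rho C X" and ?W = "representable C (apex X)"
  let ?M = "Mbar_obj C X :: ('o, 'm, 'u) module" and ?Q = "quotient_presheaf ?G K"
  have X': "src X \<in> Obj C" "apex X \<in> Obj C" "rel X \<in> Obj C"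
      "gam X \<in> arrows C (src X) (apex X)" "rho X \<in> arrows C (rel X) (apex X)"
    using X by (auto simp: cospans_def)
  note W = representable_additive_presheaf[OF X'(2)]
  note g = representable_map_nat_transf[OF X'(1,2,4)]
    and r = representable_map_nat_transf[OF X'(3,2,5)]
  note sA = representable_additive_presheaf[OF X'(1)] and sR = representable_additive_presheaf[OF X'(3)]
  have G: "additive_presheaf C ?G"
    unfolding im_gam_def by (rule image_additive_presheaf[OF sA W g])
  have res_G: "res ?G = res ?W" and mult_G: "val ?G S = (val ?W S)\<lparr>carrier := carrier (val ?G S)\<rparr>" for S
    by (simp_all add: im_gam_def image_presheaf_def)
  have car_G: "carrier (val ?G S) = (\<lambda>f. cmp C S (src X) (apex X) f (gam X)) ` arrows C S (src X)"
    and car_R: "carrier (val ?R S) = (\<lambda>f. cmp C S (rel X) (apex X) f (rho X)) ` arrows C S (rel X)"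
    if "S \<in> Obj C" for S
    using that by (simp_all add: im_gam_def im_rho_def image_presheaf_def representable_def
        representable_map_def)
  have car_K: "carrier (val K S) = carrier (val ?R S) \<inter> carrier (val ?G S)" for S
    by (simp add: K_def inter_presheaf_def)
  have sub: "subgroup (carrier (val K S)) (val ?G S)" if S: "S \<in> Obj C" for S
  proof -
    \<comment> \<open>\<open>im_rho\<close> need not lie inside \<open>im_gam\<close>, so both are
      intersected as subgroups of the ambient \<open>?W\<close>, and the result is then viewed
      inside \<open>?G\<close>.\<close>
    have sG: "subgroup (carrier (val ?G S)) (val ?W S)"
      using image_subgroup[OF sA W g S] by (simp add: im_gam_def image_presheaf_def)
    moreover have "subgroup (carrier (val ?R S)) (val ?W S)"
      using image_subgroup[OF sR W r S] by (simp add: im_rho_def image_presheaf_def)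
    ultimately have "subgroup (carrier (val K S)) (val ?W S)"
      unfolding car_K using group.subgroups_Inter_pair[OF presheaf_group[OF W S]] by blast
    then show ?thesis
      using group.subgroup_incl[OF presheaf_group[OF W S] _ sG] mult_G[of S] car_K by simp
  qed
  have stable: "res ?G S T f x \<in> carrier (val K S)"
    if S: "S \<in> Obj C" and T: "T \<in> Obj C" and f: "f \<in> arrows C S T" and x: "x \<in> carrier (val K T)"
    for S T f x
    using image_stable[OF sA g S T f, of x] image_stable[OF sR r S T f, of x] x
    by (simp add: car_K im_gam_def im_rho_def image_presheaf_def)
  let ?c = "\<lambda>S w. carrier (val K S) #>\<^bsub>val ?G S\<^esub> w"
  have q: "res ?Q S T f (?c T w) = ?c S (res ?G S T f w)"
    if "S \<in> Obj C" "T \<in> Obj C" "f \<in> arrows C S T" "w \<in> carrier (val ?G T)" for S T f w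
    by (rule quotient_res[OF G _ _ that]) (fact sub stable)+
  have Q: "additive_presheaf C ?Q"
    by (rule quotient_additive_presheaf[OF G]) (fact sub stable)+
  have M: "?M = transport Arrows ?Q" by (simp add: Mbar_obj_def K_def)
  have add: "additive_presheaf C ?M"
    unfolding M by (rule transport_additive_presheaf[OF Q inj_Arrows])
  have \<gamma>: "gam X \<in> carrier (val ?G (src X))"
    using car_G[OF X'(1)] cmp_ident_left[OF X'(1,2,4)] ident_closed[OF X'(1)] by force
  have car_M: "carrier (val ?M S) = (\<lambda>w. Arrows (?c S w)) ` carrier (val ?G S)" for S
    by (auto simp: M transport_def quotient_presheaf_def FactGroup_def RCOSETS_def)
  have one_M: "\<one>\<^bsub>val ?M S\<^esub> = Arrows (carrier (val K S))" for S
    by (simp add: M transport_def quotient_presheaf_def FactGroup_def)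
  have res_M: "res ?M S (src X) f (Arrows (?c (src X) (gam X))) =
      Arrows (?c S (cmp C S (src X) (apex X) f (gam X)))"
    if S: "S \<in> Obj C" and f: "f \<in> arrows C S (src X)" for S f
    using q[OF S X'(1) f \<gamma>]
    by (simp add: M transport_def res_G representable_def)
  have "?c S (cmp C S (src X) (apex X) f (gam X)) = carrier (val K S) \<longleftrightarrow> f \<in> Syz C X S"
    if S: "S \<in> Obj C" and f: "f \<in> arrows C S (src X)" for S f
  proof -
    have "cmp C S (src X) (apex X) f (gam X) \<in> carrier (val ?G S)"
      unfolding car_G[OF S] using f by (rule imageI)
    \<comment> \<open>The composite lies in \<open>im_gam\<close> by construction, so membership in
      the intersection K only tests \<open>im_rho\<close>, where a preimage is precisely a syzygy
      witness.\<close>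
    then have "?c S (cmp C S (src X) (apex X) f (gam X)) = carrier (val K S) \<longleftrightarrow>
        cmp C S (src X) (apex X) f (gam X) \<in> carrier (val ?R S)"
      using group.coset_join1[OF presheaf_group[OF G S] _ _ sub[OF S]]
        group.coset_join2[OF presheaf_group[OF G S] _ sub[OF S]]
      unfolding car_K[of S] by blast
    then show ?thesis using f by (auto simp: car_R[OF S] Syz_def)
  qed
  moreover have "\<exists>f\<in>arrows C S (src X). y = Arrows (?c S (cmp C S (src X) (apex X) f (gam X)))"
    if "S \<in> Obj C" "y \<in> carrier (val ?M S)" for S y
    using that by (auto simp: car_M car_G)
  moreover have "Arrows (?c (src X) (gam X)) \<in> carrier (val ?M (src X))"
    using \<gamma> by (simp add: car_M)
  ultimately show ?thesis
    using X X'(1) add by (simp add: presented_by_def generated_by_def res_M one_M)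
qed

text \<open>The presented modules are replete and contain all values of the functor, so they are one
  of the sets being intersected. Conversely, a presented module is isomorphic to the value at its
  own cospan, hence belongs to each of these sets.\<close>

lemma essential_image_Mbar: "essential_image (QCat C) (ModCat C) (Mbar C) = presented C"
proof
  have "on_obj (Mbar C) ` Obj (QCat C) \<subseteq> presented C"
    using Mbar_presented_by
    by (auto simp: Mbar_def QCat_def quotient_category_def Aux_def presented_def)
  moreover have "presented C \<subseteq> Obj (ModCat C)"
    using presented_additive_presheaf by (auto simp: Obj_ModCat)
  ultimately show "essential_image (QCat C) (ModCat C) (Mbar C) \<subseteq> presented C"
    unfolding essential_image_def by (intro Inter_lower CollectI conjI presented_replete)
  show "presented C \<subseteq> essential_image (QCat C) (ModCat C) (Mbar C)"
  proof
    fix F :: "('o, 'm, 'c) module" assume "F \<in> presented C"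
    then obtain X x where F: "presented_by C F X x" by (auto simp: presented_def)
    note X = presented_byD(1)[OF F]
    obtain \<eta> where "isomorphism (ModCat C) (Mbar_obj C X) F \<eta>"
      using presented_by_iso[OF Mbar_presented_by[OF X] F] by blast
    moreover have "F \<in> Obj (ModCat C)" using presented_byD(3)[OF F] by (simp add: Obj_ModCat)
    moreover have "Mbar_obj C X \<in> S" if "on_obj (Mbar C) ` Obj (QCat C) \<subseteq> S" for S
      using that X by (auto simp: Mbar_def QCat_def quotient_category_def Aux_def)
    ultimately show "F \<in> essential_image (QCat C) (ModCat C) (Mbar C)"
      unfolding essential_image_def replete_def by blast
  qed
qed

end

section \<open>Additivity of the subcategory of presented modules\<close>

text \<open>The image of the zero endomorphism of a presented module has visibly trivial value
  groups, and closure under images keeps it presented. The zero object of \<open>C\<close> supplies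
  an object on which to build a first cospan.\<close>

lemma (in additive_category) zero_presented:
  "\<exists>I. zero_object (full_subcategory (ModCat C) (presented C)) (I :: ('a, 'b, 'u) module)"
proof -
  obtain Z where "zero_object C Z" using ex_zero_object by blast
  then have "\<lparr>src = Z, gam = ident C Z, apex = Z, rho = ident C Z, rel = Z\<rparr> \<in> cospans C"
    by (simp add: cospans_def zero_object_def ident_closed)
  then obtain F :: "('a, 'b, 'u) module" where F: "F \<in> presented C"
    using Mbar_presented_by by (auto simp: presented_def)
  note F' = presented_additive_presheaf[OF F]
  let ?I = "image_presheaf F F \<one>\<^bsub>Hom (ModCat C) F F\<^esub>"
  have "closed_under_images C (presented C :: ('a, 'b, 'u) module set)"
    by (rule presented_closed_under_images)
  then have I: "?I \<in> presented C"
    using F zero_nat_transf[OF F' F'] by (simp add: closed_under_images_def arrows_ModCat)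
  note I' = presented_additive_presheaf[OF I]
  have I1: "x = \<one>\<^bsub>val ?I A\<^esub>" if "A \<in> Obj C" "x \<in> carrier (val ?I A)" for A x
    using that by (auto simp: image_presheaf_def one_ModCat)
  have "(\<exists>!\<eta>. \<eta> \<in> nat_transf C ?I G) \<and> (\<exists>!\<eta>. \<eta> \<in> nat_transf C G ?I)"
    if "G \<in> presented C" for G :: "('a, 'b, 'u) module"
  proof -
    note G = presented_additive_presheaf[OF that]
    have "\<eta> = \<theta>" if "\<eta> \<in> nat_transf C ?I G" "\<theta> \<in> nat_transf C ?I G" for \<eta> \<theta>
      using nat_transf_one[OF that(1) I' G] nat_transf_one[OF that(2) I' G]
      by (intro nat_transf_eqI[OF that]) (frule (1) I1, simp)
    moreover have "\<eta> = \<theta>" if "\<eta> \<in> nat_transf C G ?I" "\<theta> \<in> nat_transf C G ?I" for \<eta> \<theta>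
      using I1[OF _ nat_transf_closed[OF that(1)]] I1[OF _ nat_transf_closed[OF that(2)]]
      by (intro nat_transf_eqI[OF that]) simp
    ultimately show ?thesis
      using zero_nat_transf[OF I' G] zero_nat_transf[OF G I'] by blast
  qed
  then have "zero_object (full_subcategory (ModCat C) (presented C)) ?I"
    using I by (simp add: zero_object_def full_subcategory_def arrows_ModCat)
  then show ?thesis ..
qed

lemma (in additive_category) presented_full_replete_additive:
  "full_replete_additive_subcategory (ModCat C) (presented C :: ('a, 'b, 'u) module set)"
proof -
  have sub: "(presented C :: ('a, 'b, 'u) module set) \<subseteq> Obj (ModCat C)"
    using presented_additive_presheaf by (auto simp: Obj_ModCat)
  have "\<exists>H i j p q. biproduct (full_subcategory (ModCat C) (presented C)) F G H i j p q"
    if FG: "F \<in> presented C" "G \<in> presented C" for F G :: "('a, 'b, 'u) module"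
  proof -
    obtain X x Y y where F: "presented_by C F X x" and G: "presented_by C G Y y"
      using FG by (auto simp: presented_def)
    obtain Z i j p q where Z: "Z \<in> cospans C" "biproduct C (src X) (src Y) (src Z) i j p q"
      "\<And>S f. S \<in> Obj C \<Longrightarrow> f \<in> arrows C S (src Z) \<Longrightarrow> f \<in> Syz C Z S \<longleftrightarrow>
        cmp C S (src Z) (src X) f p \<in> Syz C X S \<and> cmp C S (src Z) (src Y) f q \<in> Syz C Y S"
      using direct_sum_cospan[OF presented_byD(1)[OF F] presented_byD(1)[OF G]] by metis
    note H = Mbar_presented_by[OF Z(1)]
    then have "Mbar_obj C Z \<in> presented C" by (auto simp: presented_def)
    moreover obtain i' j' p' q' where "biproduct (ModCat C) F G (Mbar_obj C Z) i' j' p' q'"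
      using biproduct_presented_by[OF F G H Z(2,3)] by blast
    \<comment> \<open>\<open>biproduct\<close> refers to \<open>Obj\<close> only through membership
      of the sum, so a biproduct in \<open>ModCat C\<close> whose sum is presented is one in the
      full subcategory.\<close>
    ultimately have "biproduct (full_subcategory (ModCat C) (presented C)) F G (Mbar_obj C Z) i' j' p' q'"
      by (simp add: biproduct_def full_subcategory_def)
    then show ?thesis by blast
  qed
  then have "additive_category (full_subcategory (ModCat C) (presented C :: ('a, 'b, 'u) module set))"
    by (intro additive_category.intro additive_category_axioms.intro
        preadditive_ModCat_subcategory[OF sub] zero_presented) (simp add: full_subcategory_def)
  then show ?thesis
    unfolding full_replete_additive_subcategory_def by (intro conjI sub presented_replete)
qed

section \<open>Finitely presented modules\<close>

context preadditive_category
begin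

lemma yoneda_simps:
  "carrier (val (yoneda C A) S) = Arrow ` arrows C S A"
  "Arrow f \<otimes>\<^bsub>val (yoneda C A) S\<^esub> Arrow g = Arrow (f \<otimes>\<^bsub>Hom C S A\<^esub> g)"
  "\<one>\<^bsub>val (yoneda C A) S\<^esub> = Arrow \<one>\<^bsub>Hom C S A\<^esub>"
  "res (yoneda C A) S T f (Arrow g) = Arrow (cmp C S T A f g)"
  by (simp_all add: yoneda_def transport_def representable_def)

lemma yoneda_map_Arrow:
  "S \<in> Obj C \<Longrightarrow> f \<in> arrows C S A \<Longrightarrow> yoneda_map C A B \<alpha> S (Arrow f) = Arrow (cmp C S A B f \<alpha>)"
  by (simp add: yoneda_map_def transport_map_def representable_def representable_map_def)

lemma yoneda_generated_by:
  assumes A: "A \<in> Obj C"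
  shows "generated_by C (yoneda C A) A (Arrow (ident C A))"
proof -
  have "additive_presheaf C (yoneda C A)"
    unfolding yoneda_def
    by (rule transport_additive_presheaf[OF representable_additive_presheaf[OF A] inj_Arrow])
  then show ?thesis
    using A by (auto simp: generated_by_def yoneda_simps ident_closed cmp_ident_right)
qed

lemma yoneda_map_nat_transf:
  assumes "A \<in> Obj C" "B \<in> Obj C" "\<alpha> \<in> arrows C A B"
  shows "yoneda_map C A B \<alpha> \<in> nat_transf C (yoneda C A) (yoneda C B)"
proof (rule nat_transfI)
  show "yoneda_map C A B \<alpha> \<in> extensional (Obj C)"
    by (simp add: yoneda_map_def transport_map_def)
  show "yoneda_map C A B \<alpha> S \<in> extensional (carrier (val (yoneda C A) S))" if "S \<in> Obj C" for S
    using that by (simp add: yoneda_map_def transport_map_def yoneda_simps representable_def)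
qed (use assms in \<open>auto simp: yoneda_map_Arrow yoneda_simps cmp_closed cmp_add_left cmp_assoc
      arrows_add_closed\<close>)

text \<open>The bridge between exactness and syzygies: when the left leg is an identity, a syzygy is
  an arrow that factors through \<rho>, so such a cospan presents the cokernel of the map induced by
  \<rho> on representable functors.\<close>

lemma Syz_coker_cospan:
  assumes "A \<in> Obj C" "S \<in> Obj C"
  shows "Syz C \<lparr>src = A, gam = ident C A, apex = A, rho = \<rho>, rel = R\<rparr> S =
    {f \<in> arrows C S A. f \<in> (\<lambda>g. cmp C S R A g \<rho>) ` arrows C S R}"
  using assms by (auto simp: Syz_def cmp_ident_right)

text \<open>By Yoneda, \<pi> amounts to the element \<open>?x\<close>. Surjectivity of \<pi> says
  that \<open>?x\<close> generates F, and exactness in the middle says that its annihilator consists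
  of the arrows factoring through \<alpha>.\<close>

lemma fp_subset_presented: "fp C \<subseteq> presented C"
proof
  fix F :: "('o, 'm, 'u) module" assume "F \<in> fp C"
  then obtain A B \<alpha> \<pi> where F: "additive_presheaf C F" and A: "A \<in> Obj C" and B: "B \<in> Obj C"
    and \<alpha>: "\<alpha> \<in> arrows C B A"
    and ex: "right_exact_seq C (yoneda C B) (yoneda C A) F (yoneda_map C B A \<alpha>) \<pi>"
    by (auto simp: fp_def Obj_ModCat)
  let ?X = "\<lparr>src = A, gam = ident C A, apex = A, rho = \<alpha>, rel = B\<rparr>"
  let ?x = "\<pi> A (Arrow (ident C A))"
  have \<pi>: "\<pi> \<in> nat_transf C (yoneda C A) F"
    using ex by (simp add: right_exact_seq_def arrows_ModCat)
  have id: "Arrow (ident C A) \<in> carrier (val (yoneda C A) A)"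
    by (simp add: yoneda_simps ident_closed A)
  have r: "res F S A f ?x = \<pi> S (Arrow f)" if "S \<in> Obj C" "f \<in> arrows C S A" for S f
    using nat_transf_res[OF \<pi> that(1) A that(2) id] that A
    by (simp add: yoneda_simps cmp_ident_right)
  have "\<pi> S (Arrow f) = \<one>\<^bsub>val F S\<^esub> \<longleftrightarrow> f \<in> Syz C ?X S"
    if S: "S \<in> Obj C" and f: "f \<in> arrows C S A" for S f
  proof -
    have "\<pi> S (Arrow f) = \<one>\<^bsub>val F S\<^esub> \<longleftrightarrow>
      (Arrow f :: ('m, 'u) elem) \<in> yoneda_map C B A \<alpha> S ` carrier (val (yoneda C B) S)"
    proof -
      have "yoneda_map C B A \<alpha> S ` carrier (val (yoneda C B) S) =
          kernel (val (yoneda C A) S) (val F S) (\<pi> S)"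
        using ex S by (simp add: right_exact_seq_def)
      then show ?thesis using f by (simp add: kernel_def yoneda_simps)
    qed
    also have "\<dots> \<longleftrightarrow> f \<in> (\<lambda>g. cmp C S B A g \<alpha>) ` arrows C S B"
      using S by (auto simp: yoneda_simps yoneda_map_Arrow image_image)
    finally show ?thesis using f by (simp add: Syz_coker_cospan[OF A S])
  qed
  moreover have "\<exists>f\<in>arrows C S A. y = \<pi> S (Arrow f)"
    if S: "S \<in> Obj C" and y: "y \<in> carrier (val F S)" for S y
  proof -
    have "\<pi> S ` carrier (val (yoneda C A) S) = carrier (val F S)"
      using ex S by (simp add: right_exact_seq_def)
    then show ?thesis using y by (auto simp: yoneda_simps)
  qed
  ultimately have "presented_by C F ?X ?x"
    using F A B \<alpha> nat_transf_closed[OF \<pi> A id]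
    by (simp add: presented_by_def generated_by_def cospans_def ident_closed r)
  then show "F \<in> presented C" by (auto simp: presented_def)
qed

text \<open>The converse passage, by which minimality can start: it places modules presented by such
  cospans in every subcategory that contains \<open>fp C\<close>.\<close>

lemma coker_cospan_presented_fp:
  fixes F :: "('o, 'm, 'u) module"
  assumes F: "presented_by C F \<lparr>src = A, gam = ident C A, apex = A, rho = \<rho>, rel = R\<rparr> x"
    (is "presented_by C F ?X x")
  shows "F \<in> fp C"
proof -
  note F' = presented_byD[OF F, simplified]
  have R: "R \<in> Obj C" "\<rho> \<in> arrows C R A" using F'(1) by (simp_all add: cospans_def)
  \<comment> \<open>Only the zero arrow annihilates the identity of A, so the generator of the
    representable functor may be sent to any element, here to x.\<close>
  obtain \<pi> :: "('o, 'm, 'u) module_map" where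
    \<pi>: "\<pi> \<in> nat_transf C (yoneda C A) F" "\<pi> A (Arrow (ident C A)) = x"
    by (rule generator_map[OF yoneda_generated_by[OF F'(4)] F'(3,5)])
      (simp_all add: yoneda_simps cmp_ident_right res_zero_arrow F')
  have id: "Arrow (ident C A) \<in> carrier (val (yoneda C A) A)"
    by (simp add: yoneda_simps ident_closed F')
  have r: "\<pi> S (Arrow f) = res F S A f x" if "S \<in> Obj C" "f \<in> arrows C S A" for S f
    using nat_transf_res[OF \<pi>(1) that(1) F'(4) that(2) id] that F'(4)
    by (simp add: yoneda_simps cmp_ident_right \<pi>(2))
  have "yoneda_map C R A \<rho> S ` carrier (val (yoneda C R) S) =
      kernel (val (yoneda C A) S) (val F S) (\<pi> S)" if S: "S \<in> Obj C" for S
  proof -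
    have "yoneda_map C R A \<rho> S ` carrier (val (yoneda C R) S) =
        Arrow ` (\<lambda>g. cmp C S R A g \<rho>) ` arrows C S R"
      using S by (simp add: yoneda_simps yoneda_map_Arrow image_image)
    also have "\<dots> = Arrow ` {f \<in> arrows C S A. res F S A f x = \<one>\<^bsub>val F S\<^esub>}"
      using presented_by_Syz[OF F S] Syz_coker_cospan[OF F'(4) S] cmp_closed[OF S R(1) F'(4) _ R(2)]
      by auto
    also have "\<dots> = kernel (val (yoneda C A) S) (val F S) (\<pi> S)"
      using S by (auto simp: kernel_def yoneda_simps r)
    finally show ?thesis .
  qed
  moreover have "\<pi> S ` carrier (val (yoneda C A) S) = carrier (val F S)" if S: "S \<in> Obj C" for S
  proof
    show "\<pi> S ` carrier (val (yoneda C A) S) \<subseteq> carrier (val F S)"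
      using nat_transf_closed[OF \<pi>(1) S] by blast
    show "carrier (val F S) \<subseteq> \<pi> S ` carrier (val (yoneda C A) S)"
    proof
      fix y assume "y \<in> carrier (val F S)"
      then obtain f where f: "f \<in> arrows C S A" "y = res F S A f x"
        by (rule generated_byE[OF F'(2) S])
      then have "y = \<pi> S (Arrow f)" using r[OF S] by simp
      then show "y \<in> \<pi> S ` carrier (val (yoneda C A) S)"
        using f(1) by (simp add: yoneda_simps)
    qed
  qed
  ultimately have "right_exact_seq C (yoneda C R) (yoneda C A) F (yoneda_map C R A \<rho>) \<pi>"
    using \<pi>(1) yoneda_map_nat_transf[OF R(1) F'(4) R(2)]
    by (simp add: right_exact_seq_def arrows_ModCat)
  then show ?thesis using F'(3,4) R by (auto simp: fp_def Obj_ModCat)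
qed

text \<open>
  A module presented by \<open>A \<rightarrow> \<Omega> \<leftarrow> R\<close> is the image of the composite of \<open>(-, A) \<rightarrow> (-, \<Omega>)\<close> and the
  projection onto the cokernel of \<open>(-, R) \<rightarrow> (-, \<Omega>)\<close>.
\<close>

lemma presented_subset:
  fixes \<F> :: "('o, 'm, 'u) module set"
  assumes rep: "replete (ModCat C) \<F>" and fp: "fp C \<subseteq> \<F>" and im: "closed_under_images C \<F>"
  shows "presented C \<subseteq> \<F>"
proof
  fix F :: "('o, 'm, 'u) module" assume "F \<in> presented C"
  then obtain X x where F: "presented_by C F X x" by (auto simp: presented_def)
  have X: "src X \<in> Obj C" "apex X \<in> Obj C" "rel X \<in> Obj C"
      "gam X \<in> arrows C (src X) (apex X)" "rho X \<in> arrows C (rel X) (apex X)"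
    using presented_byD(1)[OF F] by (auto simp: cospans_def)
  \<comment> \<open>The zero right leg leaves only zero syzygies, so \<open>?U\<close> presents a
    copy of the functor represented by \<open>src X\<close>; \<open>?V\<close> presents the cokernel
    of the map induced by \<open>rho X\<close>. Both have an identity as left leg and hence give
    finitely presented modules.\<close>
  let ?U = "\<lparr>src = src X, gam = ident C (src X), apex = src X, rho = \<one>\<^bsub>Hom C (src X) (src X)\<^esub>,
    rel = src X\<rparr>"
  let ?V = "\<lparr>src = apex X, gam = ident C (apex X), apex = apex X, rho = rho X, rel = rel X\<rparr>"
  obtain U :: "('o, 'm, 'u) module" and u where U: "presented_by C U ?U u"
    using Mbar_presented_by[of ?U] X by (auto simp: cospans_def ident_closed zero_closed)
  obtain V :: "('o, 'm, 'u) module" and v where V: "presented_by C V ?V v"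
    using Mbar_presented_by[of ?V] X by (auto simp: cospans_def ident_closed)
  note U' = presented_byD[OF U, simplified] and V' = presented_byD[OF V, simplified]
  note y = res_closed[OF V'(3) X(1,2,4) V'(5)]
  obtain \<eta> where \<eta>: "\<eta> \<in> nat_transf C U V" "\<eta> (src X) u = res V (src X) (apex X) (gam X) v"
  proof (rule generator_map[OF U'(2) V'(3) y])
    fix S f assume S: "S \<in> Obj C" and f: "f \<in> arrows C S (src X)"
      and "res U S (src X) f u = \<one>\<^bsub>val U S\<^esub>"
    then have "f \<in> Syz C ?U S" using presented_by_Syz[OF U S] by simp
    then have "f = \<one>\<^bsub>Hom C S (src X)\<^esub>"
      using S X(1) by (auto simp: Syz_coker_cospan cmp_zero_right)
    then show "res V S (src X) f (res V (src X) (apex X) (gam X) v) = \<one>\<^bsub>val V S\<^esub>"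
      using res_zero_arrow[OF V'(3) S X(1) y] by simp
  qed
  let ?I = "image_presheaf U V \<eta>"
  have "presented_by C ?I \<lparr>src = src X, gam = gam X, apex = apex X, rho = rho X, rel = rel X\<rparr>
    (\<eta> (src X) u)"
    using image_presented_by[OF U'(2) V \<eta>(1), of "gam X"] \<eta>(2) X cmp_ident_right[OF X(1,2,4)] by simp
  \<comment> \<open>The left leg of \<open>?V\<close> has become \<open>gam X\<close> followed by an
    identity, so all five fields are those of X, and record extensionality identifies the two
    cospans.\<close>
  then have "presented_by C ?I X (\<eta> (src X) u)" by (cases X) simp
  then obtain \<theta> where "isomorphism (ModCat C) ?I F \<theta>" using presented_by_iso[OF _ F] by blast
  moreover have "?I \<in> \<F>"
    using im fp coker_cospan_presented_fp[OF U] coker_cospan_presented_fp[OF V] \<eta>(1)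
    by (auto simp: closed_under_images_def arrows_ModCat)
  ultimately show "F \<in> \<F>"
    using rep presented_byD(3)[OF F] by (auto simp: replete_def Obj_ModCat)
qed

end

theorem corollary3p10:
  fixes P :: "('o, 'm) pcat"
    and E :: "('o, 'm, 'u) module set"
  assumes "additive_category P"
    and "E = essential_image (QCat P) (ModCat P) (Mbar P)"
  shows "full_replete_additive_subcategory (ModCat P) E \<and>
    fp P \<subseteq> E \<and> closed_under_images P E \<and>
    (\<forall>F. full_replete_additive_subcategory (ModCat P) F \<and>
       fp P \<subseteq> F \<and> closed_under_images P F \<longrightarrow> E \<subseteq> F)"
proof -
  interpret additive_category P by (rule assms(1))
  have E: "E = presented P" using assms(2) essential_image_Mbar by simp
  have "full_replete_additive_subcategory (ModCat P) E"
    unfolding E by (rule presented_full_replete_additive)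
  moreover have "fp P \<subseteq> E"
    unfolding E by (rule fp_subset_presented)
  moreover have "closed_under_images P E"
    unfolding E by (rule presented_closed_under_images)
  moreover have "E \<subseteq> F"
    if "full_replete_additive_subcategory (ModCat P) F" "fp P \<subseteq> F" "closed_under_images P F" for F
    unfolding E using presented_subset[OF _ that(2,3)] that(1)
    by (simp add: full_replete_additive_subcategory_def)
  ultimately show ?thesis by blast
qed

end
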